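(* There exists $n_0$ such that for every $n \geq n_0$ the following holds. If $\mathcal{A}, \mathcal{B} \subset S_n$ is a cross-intersecting pair of families which are not both contained within the same 1-coset, then \[\min(|\mathcal{A}|, |\mathcal{B}|) \leq (n-1)! - d_{n-1} - d_{n-2} + 1,\] with equality if and only if \[\mathcal{A} = \{\sigma \in S_n : \sigma(i) = j,\ \sigma \text{ intersects } \tau\} \cup \{\rho\}, \qquad \mathcal{B} = \{\sigma \in S_n : \sigma(i) = j,\ \sigma \text{ intersects } \rho\} \cup \{\tau\}\] for some $i, j \in [n]$ and some $\tau, \rho \in S_n$ which intersect and do not map $i$ to $j$.
   Context: $S_n$ is the symmetric group on $[n]=\{1,\ldots,n\}$. Two permutations $\sigma,\tau$ intersect if $\sigma(k)=\tau(k)$ for some $k\in[n]$. A pair of families $\mathcal{A},\mathcal{B} \subset S_n$ is cross-intersecting if every $\sigma \in \mathcal{A}$ intersects every $\tau \in \mathcal{B}$. A 1-coset of $S_n$ is a set of the form $\{\sigma \in S_n : \sigma(i)=j\}$ for some $i,j\in[n]$. $d_m$ denotes the number of derangements (fixed-point-free permutations) of an $m$-element set. *)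

theory Defs
  imports "HOL-Combinatorics.Permutations"
begin

definition Sym :: "nat \<Rightarrow> (nat \<Rightarrow> nat) set" where
  "Sym n = {p. p permutes {1..n}}"

definition perm_intersect :: "nat \<Rightarrow> (nat \<Rightarrow> nat) \<Rightarrow> (nat \<Rightarrow> nat) \<Rightarrow> bool" where
  "perm_intersect n \<sigma> \<tau> \<longleftrightarrow> (\<exists>k\<in>{1..n}. \<sigma> k = \<tau> k)"

definition cross_intersecting :: "nat \<Rightarrow> (nat \<Rightarrow> nat) set \<Rightarrow> (nat \<Rightarrow> nat) set \<Rightarrow> bool" where
  "cross_intersecting n A B \<longleftrightarrow> (\<forall>\<sigma>\<in>A. \<forall>\<tau>\<in>B. perm_intersect n \<sigma> \<tau>)"

definition one_coset :: "nat \<Rightarrow> nat \<Rightarrow> nat \<Rightarrow> (nat \<Rightarrow> nat) set" where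
  "one_coset n i j = {\<sigma> \<in> Sym n. \<sigma> i = j}"

definition derange :: "nat \<Rightarrow> nat" where
  "derange m = card {p. p permutes {1..m} \<and> (\<forall>k\<in>{1..m}. p k \<noteq> k)}"

end

theory Submission
  imports Defs Complex_Main
begin

text \<open>
  Write \<open>p i j\<close> and \<open>q i j\<close> for the proportions of \<open>A\<close> and \<open>B\<close> sending \<open>i\<close> to \<open>j\<close>. For random
  \<open>\<sigma> \<in> A\<close>, \<open>\<tau> \<in> B\<close> the number \<open>N\<close> of agreements has mean \<open>S = \<Sum> p i j * q i j\<close>. Fourth moments of
  \<open>\<sigma> \<mapsto> \<Sum>i. w i (\<sigma> i)\<close> under the uniform measure, obtained from the exchangeable pair
  \<open>(\<sigma>, \<sigma> \<circ> transpose r s)\<close>, beat the density loss \<open>n / c\<close> of families of size \<open>\<ge> c (n-1)!\<close>.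
  Hence \<open>S\<close> is at least nearly 1, and at most nearly 1 unless some cell \<open>(i, j)\<close> is heavy for
  both families. Applied to the sub-families through a common cell, this shows that
  \<open>N \<ge> 2\<close> has probability bounded below, so \<open>N \<ge> 1\<close> throughout forces \<open>S \<ge> 1 + const\<close>.
  Cross-intersecting dense families therefore have a common heavy cell, and applying this
  once more to the part of \<open>A\<close> outside and the part of \<open>B\<close> inside that 1-coset shows
  that all but a small multiple of \<open>(n-1)!\<close> elements lie in the 1-coset. Finally, a switching argument
  shows that \<open>m \<ge> 2\<close> elements of one family outside the 1-coset exclude at least \<open>m\<close> more
  permutations from the other family than a single one does; taking \<open>m\<close> to be the larger of the two
  outside parts leaves only one element outside on each side.
\<close>

subsection \<open>Moments of permutation sums\<close>

text \<open>A family of size \<open>c (n-1)!\<close> has proportion only \<open>c / n\<close> among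
  all permutations. With \<open>V\<close> the sum of the squared weights, a second moment of order
  \<open>V / n\<close> therefore becomes \<open>V / c\<close> on the family: bounded, but not small.
  For weights at most \<open>\<epsilon>\<close> the fourth moment is of order
  \<open>\<epsilon>^2 V / n + (V / n)^2\<close>, which stays negligible after multiplication by
  \<open>n / c\<close> once \<open>\<epsilon>\<close> is small and \<open>n\<close> is large. The
  price is that cells of large frequency need separate treatment; for them the second moment
  suffices, as it bounds their total frequency. In the exact part the constants form a chain:
  \<open>1 / 32\<close> bounds from below the proportion of permutations avoiding two given ones,
  \<open>1 / 64\<close> the share of a 1-coset that meets an outside permutation, hence the density
  of a pair attaining the bound, and \<open>1 / 128\<close> is the share of \<open>(n-1)!\<close> up
  to which the switching count works. Stability is thus needed only to a fixed precision.\<close>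

definition permsum :: "'a set \<Rightarrow> ('a \<Rightarrow> 'a \<Rightarrow> real) \<Rightarrow> ('a \<Rightarrow> 'a) \<Rightarrow> real" where
  "permsum U w \<sigma> = (\<Sum>i\<in>U. w i (\<sigma> i))"

definition permdev :: "'a set \<Rightarrow> ('a \<Rightarrow> 'a \<Rightarrow> real) \<Rightarrow> ('a \<Rightarrow> 'a) \<Rightarrow> real" where
  "permdev U w \<sigma> = permsum U w \<sigma> - (\<Sum>i\<in>U. \<Sum>j\<in>U. w i j) / real (card U)"

lemma sum_permutes_comp_transpose:
  assumes "r \<in> U" "s \<in> U"
  shows "(\<Sum>\<sigma>\<in>{\<sigma>. \<sigma> permutes U}. g (\<sigma> \<circ> transpose r s)) = (\<Sum>\<sigma>\<in>{\<sigma>. \<sigma> permutes U}. g \<sigma>)"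
proof -
  have t: "transpose r s permutes U" using assms by (rule permutes_swap_id)
  show ?thesis
    by (rule sum.reindex_bij_witness[of _ "\<lambda>\<sigma>. \<sigma> \<circ> transpose r s" "\<lambda>\<sigma>. \<sigma> \<circ> transpose r s"])
       (auto simp: o_assoc[symmetric] intro: permutes_compose[OF t])
qed

lemma permsum_comp_transpose:
  assumes "finite U" "r \<in> U" "s \<in> U"
  shows "permsum U w \<sigma> - permsum U w (\<sigma> \<circ> transpose r s)
       = w r (\<sigma> r) + w s (\<sigma> s) - w r (\<sigma> s) - w s (\<sigma> r)"
proof (cases "r = s")
  case True then show ?thesis by simp
next
  case False
  have eq: "sum f U = f r + (f s + sum f (U - {r} - {s}))" for f :: "'a \<Rightarrow> real"
    using assms False by (simp add: sum.remove[of U r] sum.remove[of "U - {r}" s])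
  have "(\<Sum>i\<in>U - {r} - {s}. w i ((\<sigma> \<circ> transpose r s) i)) = (\<Sum>i\<in>U - {r} - {s}. w i (\<sigma> i))"
    by (rule sum.cong) (auto simp: transpose_apply_other)
  then show ?thesis unfolding permsum_def
    unfolding eq[of "\<lambda>i. w i (\<sigma> i)"] eq[of "\<lambda>i. w i ((\<sigma> \<circ> transpose r s) i)"] by simp
qed

lemma permdev_comp_transpose:
  assumes "finite U" "r \<in> U" "s \<in> U"
  shows "permdev U w \<sigma> - permdev U w (\<sigma> \<circ> transpose r s)
       = w r (\<sigma> r) + w s (\<sigma> s) - w r (\<sigma> s) - w s (\<sigma> r)"
  using permsum_comp_transpose[OF assms, of w \<sigma>] by (simp add: permdev_def)

lemma sum_permutes_apply:
  assumes "\<sigma> permutes U"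
  shows "(\<Sum>i\<in>U. g (\<sigma> i)) = (\<Sum>i\<in>U. g i)"
  using sum.permute[OF assms, of g] by (simp add: comp_def)

text \<open>The linear regression property of Stein's method: for random \<open>r\<close>,
  \<open>s\<close>, with \<open>r = s\<close> allowed, the expected drop is
  \<open>2 / card U\<close> times the deviation. The two crossed terms sum to the total weight
  whatever \<sigma> is, and the other two reproduce \<open>permsum\<close>.\<close>

lemma sum_permdev_transpose:
  assumes U: "finite U" "U \<noteq> {}" and \<sigma>: "\<sigma> permutes U"
  shows "(\<Sum>r\<in>U. \<Sum>s\<in>U. permdev U w \<sigma> - permdev U w (\<sigma> \<circ> transpose r s))
       = 2 * real (card U) * permdev U w \<sigma>"
proof -
  have a: "(\<Sum>s\<in>U. w r (\<sigma> s)) = (\<Sum>j\<in>U. w r j)" for r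
    using sum_permutes_apply[OF \<sigma>] by blast
  have b: "(\<Sum>r\<in>U. \<Sum>s\<in>U. w s (\<sigma> r)) = (\<Sum>i\<in>U. \<Sum>j\<in>U. w i j)"
    using sum.swap[of "\<lambda>r s. w s (\<sigma> r)" U U] by (simp add: a)
  have "(\<Sum>r\<in>U. \<Sum>s\<in>U. permdev U w \<sigma> - permdev U w (\<sigma> \<circ> transpose r s))
      = (\<Sum>r\<in>U. \<Sum>s\<in>U. w r (\<sigma> r) + w s (\<sigma> s) - w r (\<sigma> s) - w s (\<sigma> r))"
    using U by (intro sum.cong refl permdev_comp_transpose) auto
  also have "\<dots> = 2 * real (card U) * permsum U w \<sigma> - 2 * (\<Sum>i\<in>U. \<Sum>j\<in>U. w i j)"
    by (simp add: sum.distrib sum_subtractf a b permsum_def sum_distrib_left[symmetric])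
  also have "\<dots> = 2 * real (card U) * permdev U w \<sigma>"
    using U by (simp add: permdev_def right_diff_distrib)
  finally show ?thesis .
qed

text \<open>Multiplying the regression identity by \<open>h\<close> of the deviation and
  antisymmetrising trades a moment for increments, each involving only four weights. The cases used
  are \<open>h = 1\<close>, \<open>h x = x\<close> and \<open>h x = x ^ 3\<close>.\<close>

lemma sum_exchangeable_pair:
  assumes U: "finite U" "U \<noteq> {}"
  shows "2 * real (card U) * (\<Sum>\<sigma>\<in>{\<sigma>. \<sigma> permutes U}. permdev U w \<sigma> * h (permdev U w \<sigma>))
       = (\<Sum>r\<in>U. \<Sum>s\<in>U. \<Sum>\<sigma>\<in>{\<sigma>. \<sigma> permutes U}.
            (permdev U w \<sigma> - permdev U w (\<sigma> \<circ> transpose r s))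
          * (h (permdev U w \<sigma>) - h (permdev U w (\<sigma> \<circ> transpose r s)))) / 2"
proof -
  let ?P = "{\<sigma>. \<sigma> permutes U}"
  let ?X = "permdev U w"
  have anti: "(\<Sum>\<sigma>\<in>?P. (?X \<sigma> - ?X (\<sigma> \<circ> transpose r s)) * h (?X (\<sigma> \<circ> transpose r s)))
      = - (\<Sum>\<sigma>\<in>?P. (?X \<sigma> - ?X (\<sigma> \<circ> transpose r s)) * h (?X \<sigma>))" if "r \<in> U" "s \<in> U" for r s
    using sum_permutes_comp_transpose[OF that, of "\<lambda>\<sigma>. (?X (\<sigma> \<circ> transpose r s) - ?X \<sigma>) * h (?X \<sigma>)"]
    by (simp add: o_assoc[symmetric] sum_negf[symmetric] algebra_simps)
  have half: "(\<Sum>\<sigma>\<in>?P. (?X \<sigma> - ?X (\<sigma> \<circ> transpose r s)) * (h (?X \<sigma>) - h (?X (\<sigma> \<circ> transpose r s))))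
      = 2 * (\<Sum>\<sigma>\<in>?P. (?X \<sigma> - ?X (\<sigma> \<circ> transpose r s)) * h (?X \<sigma>))" if "r \<in> U" "s \<in> U" for r s
    using anti[OF that] by (simp add: right_diff_distrib[of _ "h _" "h _"] sum_subtractf)
  have "2 * real (card U) * (\<Sum>\<sigma>\<in>?P. ?X \<sigma> * h (?X \<sigma>))
      = (\<Sum>\<sigma>\<in>?P. (\<Sum>r\<in>U. \<Sum>s\<in>U. ?X \<sigma> - ?X (\<sigma> \<circ> transpose r s)) * h (?X \<sigma>))"
    using sum_permdev_transpose[OF U] by (simp add: sum_distrib_left mult.assoc)
  also have "\<dots> = (\<Sum>\<sigma>\<in>?P. \<Sum>r\<in>U. \<Sum>s\<in>U. (?X \<sigma> - ?X (\<sigma> \<circ> transpose r s)) * h (?X \<sigma>))"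
    by (simp add: sum_distrib_right)
  also have "\<dots> = (\<Sum>r\<in>U. \<Sum>\<sigma>\<in>?P. \<Sum>s\<in>U. (?X \<sigma> - ?X (\<sigma> \<circ> transpose r s)) * h (?X \<sigma>))"
    by (rule sum.swap)
  also have "\<dots> = (\<Sum>r\<in>U. \<Sum>s\<in>U. \<Sum>\<sigma>\<in>?P. (?X \<sigma> - ?X (\<sigma> \<circ> transpose r s)) * h (?X \<sigma>))"
    by (rule sum.cong[OF refl]) (rule sum.swap)
  also have "\<dots> = (\<Sum>r\<in>U. \<Sum>s\<in>U. \<Sum>\<sigma>\<in>?P.
        (?X \<sigma> - ?X (\<sigma> \<circ> transpose r s)) * (h (?X \<sigma>) - h (?X (\<sigma> \<circ> transpose r s)))) / 2"
    by (simp add: half sum_distrib_left[symmetric])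
  finally show ?thesis .
qed

text \<open>The case \<open>h = 1\<close> of the exchangeable-pair identity: the increments of
  \<open>h\<close> vanish, so the deviations sum to zero.\<close>

lemma permsum_mean:
  assumes U: "finite U" "U \<noteq> {}"
  shows "(\<Sum>\<sigma>\<in>{\<sigma>. \<sigma> permutes U}. permsum U w \<sigma>)
       = fact (card U) * (\<Sum>i\<in>U. \<Sum>j\<in>U. w i j) / real (card U)"
  using sum_exchangeable_pair[OF U, of w "\<lambda>_. 1"] U card_permutations[OF refl U(1)]
  by (simp add: permdev_def sum_subtractf)

text \<open>Nonnegativity allows the cross term \<open>- 2 (a + b) (c + d)\<close> to be dropped, so
  the factor is 2 instead of the 4 of Cauchy-Schwarz.\<close>

lemma four_term_square:
  fixes a b c d :: real
  assumes "0 \<le> a" "0 \<le> b" "0 \<le> c" "0 \<le> d"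
  shows "(a + b - c - d)\<^sup>2 \<le> 2 * (a\<^sup>2 + b\<^sup>2 + c\<^sup>2 + d\<^sup>2)"
proof -
  have "(a + b - c - d)\<^sup>2 \<le> (a + b)\<^sup>2 + (c + d)\<^sup>2"
    using assms by (simp add: power2_eq_square algebra_simps)
  also have "\<dots> \<le> 2 * (a\<^sup>2 + b\<^sup>2 + c\<^sup>2 + d\<^sup>2)"
    using sum_squares_bound[of a b] sum_squares_bound[of c d]
    by (simp add: power2_eq_square algebra_simps)
  finally show ?thesis .
qed

text \<open>The bound keeps its dependence on \<sigma>, because the fourth moment needs it
  multiplied by the squared deviation before averaging.\<close>

lemma sum_permdev_transpose_square:
  assumes U: "finite U" and \<sigma>: "\<sigma> permutes U" and w: "\<And>i j. 0 \<le> w i j"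
  shows "(\<Sum>r\<in>U. \<Sum>s\<in>U. (permdev U w \<sigma> - permdev U w (\<sigma> \<circ> transpose r s))\<^sup>2)
       \<le> 4 * (real (card U) * permsum U (\<lambda>i j. (w i j)\<^sup>2) \<sigma> + (\<Sum>i\<in>U. \<Sum>j\<in>U. (w i j)\<^sup>2))"
proof -
  have a: "(\<Sum>s\<in>U. (w r (\<sigma> s))\<^sup>2) = (\<Sum>j\<in>U. (w r j)\<^sup>2)" for r
    using sum_permutes_apply[OF \<sigma>, of "\<lambda>j. (w r j)\<^sup>2"] .
  have b: "(\<Sum>r\<in>U. \<Sum>s\<in>U. (w s (\<sigma> r))\<^sup>2) = (\<Sum>i\<in>U. \<Sum>j\<in>U. (w i j)\<^sup>2)"
    using sum.swap[of "\<lambda>r s. (w s (\<sigma> r))\<^sup>2" U U] by (simp add: a)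
  have "(\<Sum>r\<in>U. \<Sum>s\<in>U. (permdev U w \<sigma> - permdev U w (\<sigma> \<circ> transpose r s))\<^sup>2)
      \<le> (\<Sum>r\<in>U. \<Sum>s\<in>U. 2 * ((w r (\<sigma> r))\<^sup>2 + (w s (\<sigma> s))\<^sup>2 + (w r (\<sigma> s))\<^sup>2 + (w s (\<sigma> r))\<^sup>2))"
    using U by (intro sum_mono) (simp only: permdev_comp_transpose four_term_square w)
  also have "\<dots> = 4 * (real (card U) * permsum U (\<lambda>i j. (w i j)\<^sup>2) \<sigma> + (\<Sum>i\<in>U. \<Sum>j\<in>U. (w i j)\<^sup>2))"
    by (simp add: sum.distrib a b permsum_def sum_distrib_left[symmetric])
  finally show ?thesis .
qed

lemma permdev_second_moment:
  assumes U: "finite U" "U \<noteq> {}" and w: "\<And>i j. 0 \<le> w i j"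
  shows "(\<Sum>\<sigma>\<in>{\<sigma>. \<sigma> permutes U}. (permdev U w \<sigma>)\<^sup>2)
       \<le> fact (card U) * (2 * (\<Sum>i\<in>U. \<Sum>j\<in>U. (w i j)\<^sup>2) / real (card U))"
proof -
  let ?P = "{\<sigma>. \<sigma> permutes U}"
  let ?X = "permdev U w"
  let ?V = "\<Sum>i\<in>U. \<Sum>j\<in>U. (w i j)\<^sup>2"
  let ?n = "real (card U)"
  have n: "?n > 0" using U by (simp add: card_gt_0_iff)
  have "2 * ?n * (\<Sum>\<sigma>\<in>?P. (?X \<sigma>)\<^sup>2)
      = (\<Sum>r\<in>U. \<Sum>s\<in>U. \<Sum>\<sigma>\<in>?P. (?X \<sigma> - ?X (\<sigma> \<circ> transpose r s))\<^sup>2) / 2"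
    using sum_exchangeable_pair[OF U, of w "\<lambda>x. x"] by (simp add: power2_eq_square)
  also have "\<dots> = (\<Sum>r\<in>U. \<Sum>\<sigma>\<in>?P. \<Sum>s\<in>U. (?X \<sigma> - ?X (\<sigma> \<circ> transpose r s))\<^sup>2) / 2"
    by (rule arg_cong[where f = "\<lambda>x. x / 2"], rule sum.cong[OF refl], rule sum.swap)
  also have "\<dots> = (\<Sum>\<sigma>\<in>?P. \<Sum>r\<in>U. \<Sum>s\<in>U. (?X \<sigma> - ?X (\<sigma> \<circ> transpose r s))\<^sup>2) / 2"
    by (rule arg_cong[where f = "\<lambda>x. x / 2"], rule sum.swap)
  also have "\<dots> \<le> (\<Sum>\<sigma>\<in>?P. 4 * (?n * permsum U (\<lambda>i j. (w i j)\<^sup>2) \<sigma> + ?V)) / 2"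
    using U w by (intro divide_right_mono sum_mono sum_permdev_transpose_square) auto
  also have "\<dots> = 2 * ?n * (fact (card U) * (2 * ?V / ?n))"
    using n by (simp add: sum.distrib sum_distrib_left[symmetric] permsum_mean[OF U] card_permutations[OF refl U(1)])
  finally show ?thesis using n by (simp only: mult_le_cancel_left_pos zero_less_mult_iff zero_less_numeral simp_thms)
qed

text \<open>The squared increments bring in \<open>Q\<close>, the permutation sum of the squared
  weights. Half of the fourth moment is absorbed on the left; the remaining square of
  \<open>Q\<close> is controlled by the second moment bound for the squared weights, where
  \<open>w i j \<le> \<epsilon>\<close> supplies the factor
  \<open>\<epsilon>\<^sup>2\<close>.\<close>

lemma permdev_fourth_moment:
  assumes U: "finite U" "U \<noteq> {}" and w: "\<And>i j. 0 \<le> w i j" "\<And>i j. w i j \<le> \<epsilon>"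
  defines "V \<equiv> \<Sum>i\<in>U. \<Sum>j\<in>U. (w i j)\<^sup>2"
  shows "(\<Sum>\<sigma>\<in>{\<sigma>. \<sigma> permutes U}. (permdev U w \<sigma>) ^ 4)
       \<le> fact (card U) * (18 * \<epsilon>\<^sup>2 * V / real (card U) + 36 * V\<^sup>2 / (real (card U))\<^sup>2)"
proof -
  let ?P = "{\<sigma>. \<sigma> permutes U}"
  let ?X = "permdev U w"
  let ?n = "real (card U)"
  define Q where "Q \<sigma> = permsum U (\<lambda>i j. (w i j)\<^sup>2) \<sigma>" for \<sigma>
  define D where "D \<sigma> = permdev U (\<lambda>i j. (w i j)\<^sup>2) \<sigma>" for \<sigma>
  have n: "?n > 0" using U by (simp add: card_gt_0_iff)
  have QD: "Q \<sigma> = D \<sigma> + V / ?n" for \<sigma> by (simp add: Q_def D_def permdev_def V_def)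
  have key: "(x - y) * (x ^ 3 - y ^ 3) \<le> 3 / 2 * ((x - y)\<^sup>2 * x\<^sup>2 + (x - y)\<^sup>2 * y\<^sup>2)" for x y :: real
  proof -
    have "(x - y) * (x ^ 3 - y ^ 3) = (x - y)\<^sup>2 * (x\<^sup>2 + x * y + y\<^sup>2)"
      by (simp add: power2_eq_square power3_eq_cube algebra_simps)
    also have "\<dots> \<le> (x - y)\<^sup>2 * (3 / 2 * (x\<^sup>2 + y\<^sup>2))"
      using sum_squares_bound[of x y] by (intro mult_left_mono) auto
    finally show ?thesis by (simp add: algebra_simps)
  qed
  have sym: "(\<Sum>\<sigma>\<in>?P. (?X \<sigma> - ?X (\<sigma> \<circ> transpose r s))\<^sup>2 * (?X (\<sigma> \<circ> transpose r s))\<^sup>2)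
      = (\<Sum>\<sigma>\<in>?P. (?X \<sigma> - ?X (\<sigma> \<circ> transpose r s))\<^sup>2 * (?X \<sigma>)\<^sup>2)" if "r \<in> U" "s \<in> U" for r s
    using sum_permutes_comp_transpose[OF that, of "\<lambda>\<sigma>. (?X (\<sigma> \<circ> transpose r s) - ?X \<sigma>)\<^sup>2 * (?X \<sigma>)\<^sup>2"]
    by (simp add: o_assoc[symmetric] power2_commute)
  have "2 * ?n * (\<Sum>\<sigma>\<in>?P. (?X \<sigma>) ^ 4)
      = (\<Sum>r\<in>U. \<Sum>s\<in>U. \<Sum>\<sigma>\<in>?P. (?X \<sigma> - ?X (\<sigma> \<circ> transpose r s))
          * ((?X \<sigma>) ^ 3 - (?X (\<sigma> \<circ> transpose r s)) ^ 3)) / 2"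
    using sum_exchangeable_pair[OF U, of w "\<lambda>x. x ^ 3"] by (simp add: power_eq_if)
  also have "\<dots> \<le> (\<Sum>r\<in>U. \<Sum>s\<in>U. \<Sum>\<sigma>\<in>?P. 3 / 2 * ((?X \<sigma> - ?X (\<sigma> \<circ> transpose r s))\<^sup>2 * (?X \<sigma>)\<^sup>2
      + (?X \<sigma> - ?X (\<sigma> \<circ> transpose r s))\<^sup>2 * (?X (\<sigma> \<circ> transpose r s))\<^sup>2)) / 2"
    by (intro divide_right_mono sum_mono key) auto
  also have "\<dots> = 3 / 2 * (\<Sum>r\<in>U. \<Sum>s\<in>U. \<Sum>\<sigma>\<in>?P. (?X \<sigma> - ?X (\<sigma> \<circ> transpose r s))\<^sup>2 * (?X \<sigma>)\<^sup>2)"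
    by (simp add: sum.distrib sym sum_distrib_left[symmetric] sum_divide_distrib[symmetric])
  also have "\<dots> = 3 / 2 * (\<Sum>r\<in>U. \<Sum>\<sigma>\<in>?P. \<Sum>s\<in>U. (?X \<sigma> - ?X (\<sigma> \<circ> transpose r s))\<^sup>2 * (?X \<sigma>)\<^sup>2)"
    by (rule arg_cong[where f = "\<lambda>x. 3 / 2 * x"], rule sum.cong[OF refl], rule sum.swap)
  also have "\<dots> = 3 / 2 * (\<Sum>\<sigma>\<in>?P. \<Sum>r\<in>U. \<Sum>s\<in>U. (?X \<sigma> - ?X (\<sigma> \<circ> transpose r s))\<^sup>2 * (?X \<sigma>)\<^sup>2)"
    by (rule arg_cong[where f = "\<lambda>x. 3 / 2 * x"], rule sum.swap)
  also have "\<dots> = 3 / 2 * (\<Sum>\<sigma>\<in>?P. (\<Sum>r\<in>U. \<Sum>s\<in>U. (?X \<sigma> - ?X (\<sigma> \<circ> transpose r s))\<^sup>2) * (?X \<sigma>)\<^sup>2)"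
    by (simp add: sum_distrib_right)
  also have "\<dots> \<le> 3 / 2 * (\<Sum>\<sigma>\<in>?P. 4 * (?n * Q \<sigma> + V) * (?X \<sigma>)\<^sup>2)"
    unfolding Q_def V_def using U w
    by (intro mult_left_mono sum_mono mult_right_mono sum_permdev_transpose_square) auto
  also have "\<dots> = 2 * ?n * (\<Sum>\<sigma>\<in>?P. 3 * (Q \<sigma> + V / ?n) * (?X \<sigma>)\<^sup>2)"
    unfolding sum_distrib_left using n by (intro sum.cong refl) (simp add: field_simps)
  finally have "(\<Sum>\<sigma>\<in>?P. (?X \<sigma>) ^ 4) \<le> (\<Sum>\<sigma>\<in>?P. 3 * (Q \<sigma> + V / ?n) * (?X \<sigma>)\<^sup>2)"
    using n by (simp only: mult_le_cancel_left_pos zero_less_mult_iff zero_less_numeral simp_thms)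
  also have "\<dots> \<le> (\<Sum>\<sigma>\<in>?P. (?X \<sigma>) ^ 4 / 2 + 9 / 2 * (Q \<sigma> + V / ?n)\<^sup>2)"
  proof (rule sum_mono)
    fix \<sigma>
    have "3 * y * x\<^sup>2 \<le> x ^ 4 / 2 + 9 / 2 * y\<^sup>2" for x y :: real
      using sum_squares_bound[of "3 * y" "x\<^sup>2"] by (simp add: power_mult_distrib)
    then show "3 * (Q \<sigma> + V / ?n) * (?X \<sigma>)\<^sup>2 \<le> (?X \<sigma>) ^ 4 / 2 + 9 / 2 * (Q \<sigma> + V / ?n)\<^sup>2" .
  qed
  finally have "(\<Sum>\<sigma>\<in>?P. (?X \<sigma>) ^ 4) \<le> 9 * (\<Sum>\<sigma>\<in>?P. (Q \<sigma> + V / ?n)\<^sup>2)"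
    by (simp add: sum.distrib sum_distrib_left[symmetric] sum_divide_distrib[symmetric])
  \<comment> \<open>With \<open>Q = D + V / n\<close> the square splits into
    \<open>D\<^sup>2\<close>, a second moment, and a multiple of \<open>Q\<close> itself, for which
    the mean is enough.\<close>
  also have "(\<Sum>\<sigma>\<in>?P. (Q \<sigma> + V / ?n)\<^sup>2) = (\<Sum>\<sigma>\<in>?P. (D \<sigma>)\<^sup>2 + 4 * (V / ?n) * Q \<sigma>)"
  proof (rule sum.cong[OF refl])
    fix \<sigma>
    have "(d + v + v)\<^sup>2 = d\<^sup>2 + 4 * v * (d + v)" for d v :: real
      by (simp add: power2_eq_square algebra_simps)
    then show "(Q \<sigma> + V / ?n)\<^sup>2 = (D \<sigma>)\<^sup>2 + 4 * (V / ?n) * Q \<sigma>" by (simp only: QD)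
  qed
  also have "\<dots> = (\<Sum>\<sigma>\<in>?P. (D \<sigma>)\<^sup>2) + 4 * (V / ?n) * (fact (card U) * V / ?n)"
    unfolding sum.distrib sum_distrib_left[symmetric] Q_def permsum_mean[OF U] V_def by simp
  also have "(\<Sum>\<sigma>\<in>?P. (D \<sigma>)\<^sup>2) \<le> fact (card U) * (2 * (\<epsilon>\<^sup>2 * V) / ?n)"
  proof -
    have "(\<Sum>\<sigma>\<in>?P. (D \<sigma>)\<^sup>2) \<le> fact (card U) * (2 * (\<Sum>i\<in>U. \<Sum>j\<in>U. ((w i j)\<^sup>2)\<^sup>2) / ?n)"
      unfolding D_def by (rule permdev_second_moment[OF U]) simp
    also have "(\<Sum>i\<in>U. \<Sum>j\<in>U. ((w i j)\<^sup>2)\<^sup>2) \<le> \<epsilon>\<^sup>2 * V"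
      unfolding V_def sum_distrib_left
    proof (intro sum_mono)
      fix i j
      show "((w i j)\<^sup>2)\<^sup>2 \<le> \<epsilon>\<^sup>2 * (w i j)\<^sup>2"
        unfolding power2_eq_square[of "(w i j)\<^sup>2"] using w by (intro mult_right_mono power_mono) auto
    qed
    finally show ?thesis using n by (simp add: divide_right_mono mult_left_mono)
  qed
  finally show ?thesis
    by (simp add: power2_eq_square algebra_simps add_divide_distrib)
qed

subsection \<open>Dense families\<close>

definition freq :: "('a \<Rightarrow> 'a) set \<Rightarrow> 'a \<Rightarrow> 'a \<Rightarrow> real" where
  "freq A i j = real (card {\<sigma> \<in> A. \<sigma> i = j}) / real (card A)"

lemma freq_nonneg [simp]: "0 \<le> freq A i j"
  by (simp add: freq_def)

lemma finite_perm_family: "finite U \<Longrightarrow> A \<subseteq> {\<sigma>. \<sigma> permutes U} \<Longrightarrow> finite A"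
  using finite_permutations finite_subset by blast

lemma sum_permsum_family:
  assumes U: "finite U" and A: "A \<subseteq> {\<sigma>. \<sigma> permutes U}"
  shows "(\<Sum>\<sigma>\<in>A. permsum U w \<sigma>) = real (card A) * (\<Sum>i\<in>U. \<Sum>j\<in>U. freq A i j * w i j)"
proof (cases "A = {}")
  case False
  have fA: "finite A" using finite_perm_family[OF U A] .
  have "(\<Sum>\<sigma>\<in>A. w i (\<sigma> i)) = (\<Sum>j\<in>U. real (card {\<sigma> \<in> A. \<sigma> i = j}) * w i j)" if "i \<in> U" for i
  proof -
    have "(\<lambda>\<sigma>. \<sigma> i) ` A \<subseteq> U" using A that by (auto simp: permutes_in_image)
    from sum.group[OF fA U this, of "\<lambda>\<sigma>. w i (\<sigma> i)"]
    have "(\<Sum>\<sigma>\<in>A. w i (\<sigma> i)) = (\<Sum>j\<in>U. \<Sum>\<sigma>\<in>{\<sigma> \<in> A. \<sigma> i = j}. w i (\<sigma> i))" by simp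
    also have "\<dots> = (\<Sum>j\<in>U. \<Sum>\<sigma>\<in>{\<sigma> \<in> A. \<sigma> i = j}. w i j)"
      by (intro sum.cong) auto
    finally show ?thesis by simp
  qed
  then have "(\<Sum>\<sigma>\<in>A. permsum U w \<sigma>) = (\<Sum>i\<in>U. \<Sum>j\<in>U. real (card {\<sigma> \<in> A. \<sigma> i = j}) * w i j)"
    unfolding permsum_def by (subst sum.swap) simp
  also have "\<dots> = real (card A) * (\<Sum>i\<in>U. \<Sum>j\<in>U. freq A i j * w i j)"
    using False fA by (simp add: freq_def sum_distrib_left)
  finally show ?thesis .
qed simp

lemma sum_freq_row:
  assumes U: "finite U" and A: "A \<subseteq> {\<sigma>. \<sigma> permutes U}" "A \<noteq> {}" and i: "i \<in> U"
  shows "(\<Sum>j\<in>U. freq A i j) = 1"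
proof -
  have fA: "finite A" using finite_perm_family[OF U A(1)] .
  have "(\<lambda>\<sigma>. \<sigma> i) ` A \<subseteq> U" using A i by (auto simp: permutes_in_image)
  from sum.group[OF fA U this, of "\<lambda>\<sigma>. 1 :: real"]
  have "(\<Sum>j\<in>U. real (card {\<sigma> \<in> A. \<sigma> i = j})) = real (card A)" by simp
  then show ?thesis using A fA by (simp add: freq_def sum_divide_distrib[symmetric])
qed

lemma sum_freq:
  assumes U: "finite U" and A: "A \<subseteq> {\<sigma>. \<sigma> permutes U}" "A \<noteq> {}"
  shows "(\<Sum>i\<in>U. \<Sum>j\<in>U. freq A i j) = real (card U)"
  using sum_freq_row[OF assms] by simp

text \<open>Density is measured against \<open>(n-1)!\<close>, the size of a 1-coset, with
  \<open>c\<close> fixed while \<open>n\<close> grows. The ground set is arbitrary because the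
  argument passes from \<open>U\<close> to \<open>U - {i}\<close>.\<close>

locale dense_family =
  fixes U :: "'a set" and c :: real and A :: "('a \<Rightarrow> 'a) set"
  assumes finite_U: "finite U" and U_nonempty: "U \<noteq> {}"
    and c_pos: "0 < c"
    and family: "A \<subseteq> {\<sigma>. \<sigma> permutes U}"
    and dense: "c * fact (card U - 1) \<le> real (card A)"
begin

lemma finite_A: "finite A"
  using finite_perm_family[OF finite_U family] .

lemma card_A_pos: "0 < real (card A)"
  using mult_pos_pos[OF c_pos fact_gt_zero[of "card U - 1"]] dense by linarith

lemma A_nonempty: "A \<noteq> {}"
  using card_A_pos by auto

lemma card_U_pos: "0 < real (card U)"
  using finite_U U_nonempty by (simp add: card_gt_0_iff)

text \<open>This is the density loss: a uniform average \<open>M / n\<close> of a nonnegative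
  quantity becomes at most \<open>M / c\<close> on the family.\<close>

lemma average_le_moment:
  assumes g: "\<And>\<sigma>. 0 \<le> g \<sigma>"
    and m: "(\<Sum>\<sigma>\<in>{\<sigma>. \<sigma> permutes U}. g \<sigma>) \<le> fact (card U) * (M / real (card U))"
  shows "(\<Sum>\<sigma>\<in>A. g \<sigma>) \<le> real (card A) * (M / c)"
proof -
  have "(\<Sum>\<sigma>\<in>A. g \<sigma>) \<le> (\<Sum>\<sigma>\<in>{\<sigma>. \<sigma> permutes U}. g \<sigma>)"
    using family g finite_permutations[OF finite_U] by (intro sum_mono2) auto
  also note m
  also have "fact (card U) * (M / real (card U)) = fact (card U - 1) * M"
    using card_U_pos by (subst fact_reduce) auto
  finally have *: "(\<Sum>\<sigma>\<in>A. g \<sigma>) \<le> fact (card U - 1) * M" .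
  have "0 \<le> (\<Sum>\<sigma>\<in>A. g \<sigma>)" using g by (simp add: sum_nonneg)
  with * have "0 \<le> M" by (meson fact_gt_zero order_trans zero_le_mult_iff not_less)
  then have "fact (card U - 1) * M \<le> real (card A) / c * M"
    using dense c_pos by (intro mult_right_mono) (simp_all add: field_simps)
  with * show ?thesis by simp
qed

text \<open>By linearity the average of \<open>permdev\<close> over \<open>A\<close> is the
  difference on the left, so moment bounds turn into statements about frequencies.\<close>

lemma abs_average_dev:
  "\<bar>(\<Sum>i\<in>U. \<Sum>j\<in>U. freq A i j * w i j) - (\<Sum>i\<in>U. \<Sum>j\<in>U. w i j) / real (card U)\<bar>
    \<le> (\<Sum>\<sigma>\<in>A. \<bar>permdev U w \<sigma>\<bar>) / real (card A)"
proof -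
  have "(\<Sum>\<sigma>\<in>A. permdev U w \<sigma>) = real (card A) *
     ((\<Sum>i\<in>U. \<Sum>j\<in>U. freq A i j * w i j) - (\<Sum>i\<in>U. \<Sum>j\<in>U. w i j) / real (card U))"
    by (simp add: permdev_def sum_subtractf sum_permsum_family[OF finite_U family] right_diff_distrib)
  then have "real (card A) * \<bar>(\<Sum>i\<in>U. \<Sum>j\<in>U. freq A i j * w i j) - (\<Sum>i\<in>U. \<Sum>j\<in>U. w i j) / real (card U)\<bar>
     = \<bar>\<Sum>\<sigma>\<in>A. permdev U w \<sigma>\<bar>"
    by (simp add: abs_mult)
  also have "\<dots> \<le> (\<Sum>\<sigma>\<in>A. \<bar>permdev U w \<sigma>\<bar>)" by (rule sum_abs)
  finally show ?thesis using card_A_pos by (simp add: field_simps)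
qed

lemma average_dev_second:
  assumes w: "\<And>i j. 0 \<le> w i j" and t: "0 < t"
  shows "\<bar>(\<Sum>i\<in>U. \<Sum>j\<in>U. freq A i j * w i j) - (\<Sum>i\<in>U. \<Sum>j\<in>U. w i j) / real (card U)\<bar>
    \<le> t + 2 * (\<Sum>i\<in>U. \<Sum>j\<in>U. (w i j)\<^sup>2) / (c * t)"
proof -
  let ?V = "\<Sum>i\<in>U. \<Sum>j\<in>U. (w i j)\<^sup>2"
  \<comment> \<open>Truncation at level \<open>t\<close>: up to \<open>t\<close> the first term
    suffices, and beyond it the second one does.\<close>
  have pt: "\<bar>x\<bar> \<le> t + x\<^sup>2 / t" for x :: real
  proof (cases "\<bar>x\<bar> \<le> t")
    case True
    then show ?thesis using t by (smt (verit) divide_nonneg_pos zero_le_power2)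
  next
    case False
    then have "\<bar>x\<bar> * t \<le> \<bar>x\<bar> * \<bar>x\<bar>" by (intro mult_left_mono) auto
    then have "\<bar>x\<bar> \<le> x\<^sup>2 / t" using t by (simp add: field_simps power2_eq_square)
    then show ?thesis using t by simp
  qed
  have m: "(\<Sum>\<sigma>\<in>A. (permdev U w \<sigma>)\<^sup>2) \<le> real (card A) * (2 * ?V / c)"
    using permdev_second_moment[OF finite_U U_nonempty w] by (intro average_le_moment) auto
  have "(\<Sum>\<sigma>\<in>A. \<bar>permdev U w \<sigma>\<bar>) \<le> (\<Sum>\<sigma>\<in>A. t + (permdev U w \<sigma>)\<^sup>2 / t)"
    by (intro sum_mono pt)
  also have "\<dots> = real (card A) * t + (\<Sum>\<sigma>\<in>A. (permdev U w \<sigma>)\<^sup>2) / t"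
    by (simp add: sum.distrib sum_divide_distrib)
  also have "\<dots> \<le> real (card A) * t + real (card A) * (2 * ?V / c) / t"
    using m t by (intro add_mono divide_right_mono) auto
  also have "\<dots> = real (card A) * (t + 2 * ?V / (c * t))"
    by (simp add: distrib_left)
  finally have "(\<Sum>\<sigma>\<in>A. \<bar>permdev U w \<sigma>\<bar>) / real (card A) \<le> t + 2 * ?V / (c * t)"
    using card_A_pos by (simp add: field_simps)
  with abs_average_dev[of w] show ?thesis by linarith
qed

lemma average_dev_fourth:
  assumes w: "\<And>i j. 0 \<le> w i j" "\<And>i j. w i j \<le> \<epsilon>" and t: "0 < t"
  defines "V \<equiv> \<Sum>i\<in>U. \<Sum>j\<in>U. (w i j)\<^sup>2"
  shows "\<bar>(\<Sum>i\<in>U. \<Sum>j\<in>U. freq A i j * w i j) - (\<Sum>i\<in>U. \<Sum>j\<in>U. w i j) / real (card U)\<bar>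
    \<le> t + (18 * \<epsilon>\<^sup>2 * V + 36 * V\<^sup>2 / real (card U)) / (c * t ^ 3)"
proof -
  let ?M = "18 * \<epsilon>\<^sup>2 * V + 36 * V\<^sup>2 / real (card U)"
  \<comment> \<open>The same truncation, with the excess over \<open>t\<close> paid for by the
    fourth power.\<close>
  have pt: "\<bar>x\<bar> \<le> t + x ^ 4 / t ^ 3" for x :: real
  proof (cases "\<bar>x\<bar> \<le> t")
    case True
    then show ?thesis using t by (smt (verit) divide_nonneg_pos zero_le_even_power even_numeral zero_less_power)
  next
    case False
    then have "\<bar>x\<bar> * t ^ 3 \<le> \<bar>x\<bar> * \<bar>x\<bar> ^ 3" using t by (intro mult_left_mono power_mono) auto
    also have "\<dots> = x ^ 4" by (simp add: power_Suc[symmetric] del: power_Suc)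
    finally have "\<bar>x\<bar> \<le> x ^ 4 / t ^ 3" using t by (simp add: field_simps)
    then show ?thesis using t by simp
  qed
  have "fact (card U) * (18 * \<epsilon>\<^sup>2 * V / real (card U) + 36 * V\<^sup>2 / (real (card U))\<^sup>2)
      = fact (card U) * (?M / real (card U))"
    using card_U_pos by (simp add: field_simps power2_eq_square)
  then have m: "(\<Sum>\<sigma>\<in>A. (permdev U w \<sigma>) ^ 4) \<le> real (card A) * (?M / c)"
    using permdev_fourth_moment[of U w \<epsilon>, OF finite_U U_nonempty w, folded V_def]
    by (intro average_le_moment) auto
  have "(\<Sum>\<sigma>\<in>A. \<bar>permdev U w \<sigma>\<bar>) \<le> (\<Sum>\<sigma>\<in>A. t + (permdev U w \<sigma>) ^ 4 / t ^ 3)"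
    by (intro sum_mono pt)
  also have "\<dots> = real (card A) * t + (\<Sum>\<sigma>\<in>A. (permdev U w \<sigma>) ^ 4) / t ^ 3"
    by (simp add: sum.distrib sum_divide_distrib)
  also have "\<dots> \<le> real (card A) * t + real (card A) * (?M / c) / t ^ 3"
    using m t by (intro add_mono divide_right_mono) auto
  also have "\<dots> = real (card A) * (t + ?M / (c * t ^ 3))"
    by (simp add: distrib_left)
  finally have "(\<Sum>\<sigma>\<in>A. \<bar>permdev U w \<sigma>\<bar>) / real (card A) \<le> t + ?M / (c * t ^ 3)"
    using card_A_pos by (simp add: field_simps)
  with abs_average_dev[of w] show ?thesis by linarith
qed

text \<open>Self-application: with the frequencies of \<open>A\<close> as weights, the average over
  \<open>A\<close> is the quantity \<open>V\<close> to be bounded and the uniform mean is 1. The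
  choice \<open>t = 4 / c\<close> makes the quadratic error \<open>V / 2\<close>, which is absorbed
  on the left.\<close>

lemma sum_freq_square: "(\<Sum>i\<in>U. \<Sum>j\<in>U. (freq A i j)\<^sup>2) \<le> 2 + 8 / c"
proof -
  let ?V = "\<Sum>i\<in>U. \<Sum>j\<in>U. (freq A i j)\<^sup>2"
  have "\<bar>?V - 1\<bar> \<le> 4 / c + 2 * ?V / (c * (4 / c))"
    using average_dev_second[of "freq A" "4 / c"] c_pos card_U_pos
    by (simp add: sum_freq[OF finite_U family A_nonempty] power2_eq_square)
  then have "?V - 1 \<le> 4 / c + ?V / 2" using c_pos by simp
  then show ?thesis by (simp add: field_simps)
qed

text \<open>On a heavy cell the frequency is at most its square divided by
  \<open>\<epsilon>\<close>. The heavy mass is thus bounded independently of \<open>card U\<close>,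
  whereas the total mass is \<open>card U\<close>.\<close>

lemma sum_freq_heavy:
  assumes "0 < \<epsilon>"
  shows "(\<Sum>i\<in>U. \<Sum>j\<in>U. if freq A i j < \<epsilon> then 0 else freq A i j) \<le> (2 + 8 / c) / \<epsilon>"
proof -
  have "(if freq A i j < \<epsilon> then 0 else freq A i j) \<le> (freq A i j)\<^sup>2 / \<epsilon>" for i j
  proof (cases "freq A i j < \<epsilon>")
    case False
    then have "freq A i j * \<epsilon> \<le> freq A i j * freq A i j" by (intro mult_left_mono) auto
    then show ?thesis using False assms by (simp add: field_simps power2_eq_square)
  qed (use assms in simp)
  then have "(\<Sum>i\<in>U. \<Sum>j\<in>U. if freq A i j < \<epsilon> then 0 else freq A i j)
     \<le> (\<Sum>i\<in>U. \<Sum>j\<in>U. (freq A i j)\<^sup>2 / \<epsilon>)"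
    by (intro sum_mono)
  also have "\<dots> = (\<Sum>i\<in>U. \<Sum>j\<in>U. (freq A i j)\<^sup>2) / \<epsilon>"
    by (simp add: sum_divide_distrib)
  also have "\<dots> \<le> (2 + 8 / c) / \<epsilon>" using sum_freq_square assms by (intro divide_right_mono) auto
  finally show ?thesis .
qed

end

section \<open>Expected number of agreements between two dense families\<close>

definition overlap :: "'a set \<Rightarrow> ('a \<Rightarrow> 'a) set \<Rightarrow> ('a \<Rightarrow> 'a) set \<Rightarrow> real" where
  "overlap U A B = (\<Sum>i\<in>U. \<Sum>j\<in>U. freq A i j * freq B i j)"

lemma overlap_le:
  assumes "dense_family U c A" "dense_family U c B"
  shows "overlap U A B \<le> 2 + 8 / c"
proof -
  have "2 * overlap U A B \<le> (\<Sum>i\<in>U. \<Sum>j\<in>U. (freq A i j)\<^sup>2) + (\<Sum>i\<in>U. \<Sum>j\<in>U. (freq B i j)\<^sup>2)"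
    unfolding overlap_def sum_distrib_left sum.distrib[symmetric]
    by (intro sum_mono) (use sum_squares_bound in \<open>simp add: mult.assoc\<close>)
  also have "\<dots> \<le> 2 * (2 + 8 / c)"
    using assms[THEN dense_family.sum_freq_square] by simp
  finally show ?thesis by simp
qed

text \<open>The light frequencies of \<open>A\<close> serve as weights for a random member of
  \<open>B\<close>: they are bounded by \<open>\<epsilon>\<close> and have bounded sum of squares,
  so the fourth moment estimate applies to \<open>B\<close>.\<close>

lemma light_overlap:
  assumes c: "0 < c" and \<gamma>: "0 < \<gamma>"
  shows "\<exists>\<epsilon>>0. \<exists>n0. \<forall>(U :: 'a set) A B. dense_family U c A \<longrightarrow> dense_family U c B \<longrightarrow> n0 \<le> real (card U) \<longrightarrow>
    \<bar>(\<Sum>i\<in>U. \<Sum>j\<in>U. freq B i j * (if freq A i j < \<epsilon> then freq A i j else 0))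
     - (\<Sum>i\<in>U. \<Sum>j\<in>U. if freq A i j < \<epsilon> then freq A i j else 0) / real (card U)\<bar> \<le> \<gamma>"
proof -
  define K where "K = 2 + 8 / c"
  define t where "t = \<gamma> / 3"
  \<comment> \<open>The error budget is \<open>\<gamma> = 3 t\<close>. One \<open>t\<close> is the
    truncation level; \<open>\<epsilon>\<close> and \<open>n0\<close> make each of the two
    fourth-moment terms, divided by \<open>c t ^ 3\<close>, at most \<open>t\<close>.\<close>
  define \<epsilon> where "\<epsilon> = sqrt (c * t ^ 4 / (18 * K))"
  define n0 where "n0 = 36 * K\<^sup>2 / (c * t ^ 4)"
  have K: "0 < K" using c by (simp add: K_def pos_add_strict)
  have t: "0 < t" using \<gamma> by (simp add: t_def)
  have \<epsilon>: "0 < \<epsilon>" using c t K by (simp add: \<epsilon>_def)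
  have \<epsilon>2: "18 * \<epsilon>\<^sup>2 * K = c * t ^ 3 * t"
    using c t K by (simp add: \<epsilon>_def power4_eq_xxxx power3_eq_cube)
  have "\<bar>(\<Sum>i\<in>U. \<Sum>j\<in>U. freq B i j * (if freq A i j < \<epsilon> then freq A i j else 0))
     - (\<Sum>i\<in>U. \<Sum>j\<in>U. if freq A i j < \<epsilon> then freq A i j else 0) / real (card U)\<bar> \<le> \<gamma>"
    if A: "dense_family U c A" and B: "dense_family U c B" and n: "n0 \<le> real (card U)"
    for U :: "'a set" and A B
  proof -
    interpret A: dense_family U c A by fact
    interpret B: dense_family U c B by fact
    define w where "w = (\<lambda>i j. if freq A i j < \<epsilon> then freq A i j else 0)"
    define V where "V = (\<Sum>i\<in>U. \<Sum>j\<in>U. (w i j)\<^sup>2)"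
    have "V \<le> (\<Sum>i\<in>U. \<Sum>j\<in>U. (freq A i j)\<^sup>2)"
      unfolding V_def by (intro sum_mono) (simp add: w_def)
    with A.sum_freq_square have V: "V \<le> K" by (simp add: K_def)
    have V0: "0 \<le> V" by (simp add: V_def sum_nonneg)
    have "\<bar>(\<Sum>i\<in>U. \<Sum>j\<in>U. freq B i j * w i j) - (\<Sum>i\<in>U. \<Sum>j\<in>U. w i j) / real (card U)\<bar>
       \<le> t + (18 * \<epsilon>\<^sup>2 * V + 36 * V\<^sup>2 / real (card U)) / (c * t ^ 3)"
      unfolding V_def using \<epsilon> t by (intro B.average_dev_fourth) (auto simp: w_def)
    also have "\<dots> \<le> t + (18 * \<epsilon>\<^sup>2 * K + 36 * K\<^sup>2 / real (card U)) / (c * t ^ 3)"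
      using V V0 c t by (intro add_mono divide_right_mono mult_left_mono power_mono order_refl) auto
    also have "36 * K\<^sup>2 / real (card U) \<le> c * t ^ 3 * t"
    proof -
      have "36 * K\<^sup>2 \<le> real (card U) * (c * t ^ 4)"
        using n c t by (simp add: n0_def field_simps)
      then show ?thesis using A.card_U_pos by (simp add: field_simps power_eq_if)
    qed
    finally have "\<bar>(\<Sum>i\<in>U. \<Sum>j\<in>U. freq B i j * w i j) - (\<Sum>i\<in>U. \<Sum>j\<in>U. w i j) / real (card U)\<bar>
       \<le> t + (18 * \<epsilon>\<^sup>2 * K + c * t ^ 3 * t) / (c * t ^ 3)"
      using c t by (simp add: divide_right_mono)
    also have "\<dots> = \<gamma>" unfolding \<epsilon>2 using c t by (simp add: add_divide_distrib t_def)
    finally show ?thesis by (simp add: w_def)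
  qed
  note main = this
  show ?thesis
  proof (intro exI conjI allI impI)
    show "0 < \<epsilon>" by fact
  qed (rule main)
qed

text \<open>For large \<open>card U\<close> the heavy cells of \<open>A\<close> carry at most an
  eighth of its mass, so the light ones have uniform mean at least \<open>7 / 8\<close>. The average
  over \<open>B\<close> deviates from this by at most \<open>1 / 8\<close>, and omitting heavy cells
  only decreases the overlap.\<close>

lemma overlap_ge:
  assumes c: "0 < c"
  shows "\<exists>n0. \<forall>(U :: 'a set) A B. dense_family U c A \<longrightarrow> dense_family U c B \<longrightarrow> n0 \<le> real (card U) \<longrightarrow>
    3 / 4 \<le> overlap U A B"
proof -
  have "0 < (1 / 8 :: real)" by simp
  from light_overlap[OF c this, where 'a = 'a] obtain \<epsilon> n0 where \<epsilon>: "0 < \<epsilon>" and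
    *: "\<And>(U :: 'a set) A B. dense_family U c A \<Longrightarrow> dense_family U c B \<Longrightarrow> n0 \<le> real (card U) \<Longrightarrow>
    \<bar>(\<Sum>i\<in>U. \<Sum>j\<in>U. freq B i j * (if freq A i j < \<epsilon> then freq A i j else 0))
     - (\<Sum>i\<in>U. \<Sum>j\<in>U. if freq A i j < \<epsilon> then freq A i j else 0) / real (card U)\<bar> \<le> 1 / 8"
    by blast
  have "3 / 4 \<le> overlap U A B"
    if A: "dense_family U c A" and B: "dense_family U c B"
      and n: "max n0 (8 * ((2 + 8 / c) / \<epsilon>)) \<le> real (card U)"
    for U :: "'a set" and A B
  proof -
    interpret A: dense_family U c A by fact
    let ?l = "\<Sum>i\<in>U. \<Sum>j\<in>U. if freq A i j < \<epsilon> then freq A i j else 0"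
    let ?h = "\<Sum>i\<in>U. \<Sum>j\<in>U. if freq A i j < \<epsilon> then 0 else freq A i j"
    have "?l + ?h = (\<Sum>i\<in>U. \<Sum>j\<in>U. freq A i j)"
      unfolding sum.distrib[symmetric] by (intro sum.cong refl) auto
    also have "\<dots> = real (card U)" by (rule sum_freq[OF A.finite_U A.family A.A_nonempty])
    finally have "?l = real (card U) - ?h" by simp
    moreover have "8 * ?h \<le> real (card U)" using A.sum_freq_heavy[OF \<epsilon>] n by linarith
    ultimately have "7 / 8 \<le> ?l / real (card U)" using A.card_U_pos by (simp add: field_simps)
    moreover have "\<bar>(\<Sum>i\<in>U. \<Sum>j\<in>U. freq B i j * (if freq A i j < \<epsilon> then freq A i j else 0))
     - ?l / real (card U)\<bar> \<le> 1 / 8" using *[OF A B] n by simp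
    ultimately have "3 / 4 \<le> (\<Sum>i\<in>U. \<Sum>j\<in>U. freq B i j * (if freq A i j < \<epsilon> then freq A i j else 0))"
      by linarith
    also have "\<dots> \<le> overlap U A B"
      unfolding overlap_def by (intro sum_mono) (auto simp: mult.commute)
    finally show ?thesis .
  qed
  note main = this
  show ?thesis by (intro exI allI impI) (rule main)
qed

subsection \<open>Common heavy cells\<close>

definition agr :: "'a set \<Rightarrow> ('a \<Rightarrow> 'a) \<Rightarrow> ('a \<Rightarrow> 'a) \<Rightarrow> nat" where
  "agr U \<sigma> \<tau> = card {k \<in> U. \<sigma> k = \<tau> k}"

text \<open>The members of \<open>A\<close> sending \<open>i\<close> to \<open>j\<close>, normalised to permutations of \<open>U - {i}\<close>.\<close>

definition restr :: "'a \<Rightarrow> 'a \<Rightarrow> ('a \<Rightarrow> 'a) set \<Rightarrow> ('a \<Rightarrow> 'a) set" where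
  "restr i j A = (\<lambda>\<sigma>. transpose i j \<circ> \<sigma>) ` {\<sigma> \<in> A. \<sigma> i = j}"

lemma inj_on_transpose_comp: "inj_on (\<lambda>\<sigma>. transpose i j \<circ> \<sigma>) A"
proof (rule inj_onI)
  fix \<sigma> \<tau> assume eq: "transpose i j \<circ> \<sigma> = transpose i j \<circ> \<tau>"
  show "\<sigma> = \<tau>"
  proof
    fix x
    from fun_cong[OF eq, of x] have "transpose i j (\<sigma> x) = transpose i j (\<tau> x)" by simp
    then show "\<sigma> x = \<tau> x" by (rule injD[OF inj_transpose])
  qed
qed

lemma card_restr: "card (restr i j A) = card {\<sigma> \<in> A. \<sigma> i = j}"
  unfolding restr_def by (rule card_image[OF inj_on_transpose_comp])

lemma transpose_comp_permutes_Diff: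
  assumes "\<sigma> permutes U" "i \<in> U" "\<sigma> i = j"
  shows "transpose i j \<circ> \<sigma> permutes (U - {i})"
proof (rule permutes_superset)
  have "j \<in> U" using permutes_in_image[OF assms(1), of i] assms by simp
  then show "transpose i j \<circ> \<sigma> permutes U"
    using assms by (intro permutes_compose permutes_swap_id)
qed (use assms in auto)

lemma restr_permutes:
  assumes "A \<subseteq> {\<sigma>. \<sigma> permutes U}" "i \<in> U"
  shows "restr i j A \<subseteq> {\<sigma>. \<sigma> permutes (U - {i})}"
  unfolding restr_def using assms by (auto intro: transpose_comp_permutes_Diff)

lemma restr_all:
  assumes "i \<in> U" "j \<in> U"
  shows "restr i j {\<sigma>. \<sigma> permutes U} = {\<sigma>. \<sigma> permutes (U - {i})}"
proof
  show "restr i j {\<sigma>. \<sigma> permutes U} \<subseteq> {\<sigma>. \<sigma> permutes (U - {i})}"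
    using assms by (intro restr_permutes) auto
  show "{\<sigma>. \<sigma> permutes (U - {i})} \<subseteq> restr i j {\<sigma>. \<sigma> permutes U}"
  proof
    fix \<sigma> assume "\<sigma> \<in> {\<sigma>. \<sigma> permutes (U - {i})}"
    then have \<sigma>: "\<sigma> permutes (U - {i})" by simp
    then have "\<sigma> permutes U" by (rule permutes_subset) auto
    moreover have "\<sigma> i = i" using permutes_not_in[OF \<sigma>, of i] by simp
    ultimately have "transpose i j \<circ> \<sigma> \<in> {\<sigma> \<in> {\<sigma>. \<sigma> permutes U}. \<sigma> i = j}"
      using assms by (auto intro: permutes_compose permutes_swap_id)
    moreover have "\<sigma> = transpose i j \<circ> (transpose i j \<circ> \<sigma>)"
      by (simp add: o_assoc)
    ultimately show "\<sigma> \<in> restr i j {\<sigma>. \<sigma> permutes U}" unfolding restr_def by blast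
  qed
qed

lemma card_permutes_fixed:
  assumes "finite U" "i \<in> U" "j \<in> U"
  shows "card {\<sigma>. \<sigma> permutes U \<and> \<sigma> i = j} = fact (card U - 1)"
  using card_restr[of i j "{\<sigma>. \<sigma> permutes U}"] assms
  by (simp add: restr_all card_permutations[OF refl] card_Diff_singleton)

lemma agr_transpose:
  assumes "finite U" "i \<in> U" "\<sigma> i = j" "\<tau> i = j"
  shows "agr U \<sigma> \<tau> = Suc (agr (U - {i}) (transpose i j \<circ> \<sigma>) (transpose i j \<circ> \<tau>))"
proof -
  have "{k \<in> U. \<sigma> k = \<tau> k} = insert i {k \<in> U - {i}. (transpose i j \<circ> \<sigma>) k = (transpose i j \<circ> \<tau>) k}"
    using assms by (auto dest: injD[OF inj_transpose])
  then show ?thesis unfolding agr_def using assms by simp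
qed

text \<open>Deleting the shared cell removes exactly one agreement. The \<open>Suc\<close> is what
  converts one agreement of the restricted permutations into two agreements of the original
  ones.\<close>

lemma sum_restr:
  assumes "finite U" "i \<in> U"
  shows "(\<Sum>\<sigma>\<in>{\<sigma> \<in> A. \<sigma> i = j}. \<Sum>\<tau>\<in>{\<tau> \<in> B. \<tau> i = j}. g (agr U \<sigma> \<tau>))
       = (\<Sum>\<sigma>\<in>restr i j A. \<Sum>\<tau>\<in>restr i j B. g (Suc (agr (U - {i}) \<sigma> \<tau>)))"
  unfolding restr_def sum.reindex[OF inj_on_transpose_comp] comp_apply[of "\<lambda>\<sigma>. sum _ _"]
  using assms by (intro sum.cong refl) (auto simp: agr_transpose)

text \<open>Triples of two permutations and a point of agreement are grouped by the cell
  \<open>(k, \<sigma> k)\<close>. The summand may also depend on the permutations, so that the total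
  number of agreements can be summed over the pairs through a given cell.\<close>

lemma sum_agreements:
  fixes f :: "'a \<Rightarrow> 'a \<Rightarrow> ('a \<Rightarrow> 'a) \<Rightarrow> ('a \<Rightarrow> 'a) \<Rightarrow> real"
  assumes U: "finite U" and A: "A \<subseteq> {\<sigma>. \<sigma> permutes U}" and B: "B \<subseteq> {\<sigma>. \<sigma> permutes U}"
  shows "(\<Sum>\<sigma>\<in>A. \<Sum>\<tau>\<in>B. \<Sum>k\<in>{k \<in> U. \<sigma> k = \<tau> k}. f k (\<sigma> k) \<sigma> \<tau>)
       = (\<Sum>i\<in>U. \<Sum>j\<in>U. \<Sum>\<sigma>\<in>{\<sigma> \<in> A. \<sigma> i = j}. \<Sum>\<tau>\<in>{\<tau> \<in> B. \<tau> i = j}. f i j \<sigma> \<tau>)"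
proof -
  have fA: "finite A" and fB: "finite B" using finite_perm_family[OF U] A B by auto
  have row: "(\<Sum>\<sigma>\<in>A. \<Sum>\<tau>\<in>B. if \<sigma> k = \<tau> k then f k (\<sigma> k) \<sigma> \<tau> else 0)
     = (\<Sum>j\<in>U. \<Sum>\<sigma>\<in>{\<sigma> \<in> A. \<sigma> k = j}. \<Sum>\<tau>\<in>{\<tau> \<in> B. \<tau> k = j}. f k j \<sigma> \<tau>)" if "k \<in> U" for k
  proof -
    have "(\<lambda>\<sigma>. \<sigma> k) ` A \<subseteq> U" using A that by (auto simp: permutes_in_image)
    from sum.group[OF fA U this, of "\<lambda>\<sigma>. \<Sum>\<tau>\<in>B. if \<sigma> k = \<tau> k then f k (\<sigma> k) \<sigma> \<tau> else 0"]
    have "(\<Sum>\<sigma>\<in>A. \<Sum>\<tau>\<in>B. if \<sigma> k = \<tau> k then f k (\<sigma> k) \<sigma> \<tau> else 0)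
       = (\<Sum>j\<in>U. \<Sum>\<sigma>\<in>{\<sigma> \<in> A. \<sigma> k = j}. \<Sum>\<tau>\<in>B. if \<sigma> k = \<tau> k then f k (\<sigma> k) \<sigma> \<tau> else 0)"
      by simp
    also have "\<dots> = (\<Sum>j\<in>U. \<Sum>\<sigma>\<in>{\<sigma> \<in> A. \<sigma> k = j}. \<Sum>\<tau>\<in>{\<tau> \<in> B. \<tau> k = j}. f k j \<sigma> \<tau>)"
      by (rule sum.cong[OF refl], rule sum.cong[OF refl])
         (auto simp: sum.inter_filter[OF fB] intro!: sum.cong)
    finally show ?thesis .
  qed
  have "(\<Sum>\<sigma>\<in>A. \<Sum>\<tau>\<in>B. \<Sum>k\<in>{k \<in> U. \<sigma> k = \<tau> k}. f k (\<sigma> k) \<sigma> \<tau>)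
      = (\<Sum>\<sigma>\<in>A. \<Sum>\<tau>\<in>B. \<Sum>k\<in>U. if \<sigma> k = \<tau> k then f k (\<sigma> k) \<sigma> \<tau> else 0)"
    using U by (simp add: sum.inter_filter[symmetric])
  also have "\<dots> = (\<Sum>\<sigma>\<in>A. \<Sum>k\<in>U. \<Sum>\<tau>\<in>B. if \<sigma> k = \<tau> k then f k (\<sigma> k) \<sigma> \<tau> else 0)"
    by (rule sum.cong[OF refl]) (rule sum.swap)
  also have "\<dots> = (\<Sum>k\<in>U. \<Sum>\<sigma>\<in>A. \<Sum>\<tau>\<in>B. if \<sigma> k = \<tau> k then f k (\<sigma> k) \<sigma> \<tau> else 0)"
    by (rule sum.swap)
  also have "\<dots> = (\<Sum>i\<in>U. \<Sum>j\<in>U. \<Sum>\<sigma>\<in>{\<sigma> \<in> A. \<sigma> i = j}. \<Sum>\<tau>\<in>{\<tau> \<in> B. \<tau> i = j}. f i j \<sigma> \<tau>)"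
    by (rule sum.cong[OF refl]) (rule row)
  finally show ?thesis .
qed

lemma card_eq_freq: "finite A \<Longrightarrow> real (card {\<sigma> \<in> A. \<sigma> i = j}) = freq A i j * real (card A)"
  by (cases "A = {}") (simp_all add: freq_def)

lemma sum_weighted_agreements:
  assumes U: "finite U" and A: "A \<subseteq> {\<sigma>. \<sigma> permutes U}" and B: "B \<subseteq> {\<sigma>. \<sigma> permutes U}"
  shows "(\<Sum>\<sigma>\<in>A. \<Sum>\<tau>\<in>B. \<Sum>k\<in>{k \<in> U. \<sigma> k = \<tau> k}. f k (\<sigma> k))
       = real (card A) * real (card B) * (\<Sum>i\<in>U. \<Sum>j\<in>U. f i j * (freq A i j * freq B i j))"
proof -
  have fA: "finite A" and fB: "finite B" using finite_perm_family[OF U] A B by auto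
  show ?thesis
    unfolding sum_agreements[OF U A B, of "\<lambda>i j _ _. f i j"] sum_distrib_left
    by (intro sum.cong refl) (simp add: card_eq_freq fA fB)
qed

lemma sum_agr:
  assumes U: "finite U" and A: "A \<subseteq> {\<sigma>. \<sigma> permutes U}" and B: "B \<subseteq> {\<sigma>. \<sigma> permutes U}"
  shows "(\<Sum>\<sigma>\<in>A. \<Sum>\<tau>\<in>B. real (agr U \<sigma> \<tau>)) = real (card A) * real (card B) * overlap U A B"
  using sum_weighted_agreements[OF assms, of "\<lambda>_ _. 1"] by (simp add: overlap_def agr_def)

text \<open>The threshold is a compromise: low enough that the remaining cells contribute little
  overlap, high enough that the sub-families through a good cell are again dense.\<close>

definition good :: "'a set \<Rightarrow> ('a \<Rightarrow> 'a) set \<Rightarrow> ('a \<Rightarrow> 'a) set \<Rightarrow> 'a \<Rightarrow> 'a \<Rightarrow> bool" where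
  "good U A B i j \<longleftrightarrow> 1 / (8 * real (card U)) \<le> freq A i j \<and> 1 / (8 * real (card U)) \<le> freq B i j"

text \<open>A cell that is not good contributes at most \<open>1 / (8 n)\<close> times the sum of
  its two frequencies, where \<open>n = card U\<close>. As the frequencies of each family add up to
  \<open>n\<close>, two losses of \<open>1 / 8\<close> arise.\<close>

lemma good_overlap:
  assumes A: "dense_family U c A" and B: "dense_family U c B"
  shows "overlap U A B - 1 / 4 \<le> (\<Sum>i\<in>U. \<Sum>j\<in>U. of_bool (good U A B i j) * (freq A i j * freq B i j))"
proof -
  interpret A: dense_family U c A by fact
  interpret B: dense_family U c B by fact
  let ?d = "1 / (8 * real (card U))"
  have d: "0 < ?d" using A.card_U_pos by simp
  have "freq A i j * freq B i j - ?d * freq A i j - ?d * freq B i j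
     \<le> of_bool (good U A B i j) * (freq A i j * freq B i j)" for i j
  proof (cases "good U A B i j")
    case True
    then have "of_bool (good U A B i j) * (freq A i j * freq B i j) = freq A i j * freq B i j" by simp
    moreover have "0 \<le> ?d * freq A i j" "0 \<le> ?d * freq B i j"
      using d by (intro mult_nonneg_nonneg; simp)+
    ultimately show ?thesis by linarith
  next
    case False
    then consider "freq A i j \<le> ?d" | "freq B i j \<le> ?d" unfolding good_def by linarith
    then have "freq A i j * freq B i j \<le> ?d * freq A i j + ?d * freq B i j"
    proof cases
      case 1
      then have "freq A i j * freq B i j \<le> ?d * freq B i j" by (rule mult_right_mono) simp
      moreover have "0 \<le> ?d * freq A i j" using d by (intro mult_nonneg_nonneg) auto
      ultimately show ?thesis by linarith
    next
      case 2
      then have "freq A i j * freq B i j \<le> freq A i j * ?d" by (rule mult_left_mono) simp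
      also have "\<dots> = ?d * freq A i j" by (rule mult.commute)
      finally have "freq A i j * freq B i j \<le> ?d * freq A i j" .
      moreover have "0 \<le> ?d * freq B i j" using d by (intro mult_nonneg_nonneg) auto
      ultimately show ?thesis by linarith
    qed
    then show ?thesis using False by simp
  qed
  then have "(\<Sum>i\<in>U. \<Sum>j\<in>U. freq A i j * freq B i j - ?d * freq A i j - ?d * freq B i j)
     \<le> (\<Sum>i\<in>U. \<Sum>j\<in>U. of_bool (good U A B i j) * (freq A i j * freq B i j))"
    by (intro sum_mono)
  moreover have "(\<Sum>i\<in>U. \<Sum>j\<in>U. freq A i j * freq B i j - ?d * freq A i j - ?d * freq B i j)
     = overlap U A B - ?d * real (card U) - ?d * real (card U)"
    unfolding sum_subtractf sum_distrib_left[symmetric] overlap_def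
    by (simp only: sum_freq[OF A.finite_U A.family A.A_nonempty] sum_freq[OF B.finite_U B.family B.A_nonempty])
  moreover have "?d * real (card U) = 1 / 8" using A.card_U_pos by simp
  ultimately show ?thesis by linarith
qed

text \<open>At least \<open>c (n-1)! / (8 n)\<close> members remain, and
  \<open>n - 1 \<ge> n / 2\<close> turns this into \<open>(c / 16) (n-2)!\<close>. On
  \<open>n - 1\<close> points \<open>(n-2)!\<close> is the size of a 1-coset.\<close>

lemma dense_restr:
  assumes A: "dense_family U c A" and i: "i \<in> U" and n: "2 \<le> card U"
    and f: "1 / (8 * real (card U)) \<le> freq A i j"
  shows "dense_family (U - {i}) (c / 16) (restr i j A)"
proof -
  interpret A: dense_family U c A by fact
  define m where "m = card U - 2"
  have m: "card U = Suc (Suc m)" using n by (simp add: m_def)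
  have cU: "card (U - {i}) = Suc m" using A.finite_U i m by simp
  show ?thesis
  proof
    show "finite (U - {i})" using A.finite_U by simp
    show "U - {i} \<noteq> {}" using cU by (intro notI) simp
    show "0 < c / 16" using A.c_pos by simp
    show "restr i j A \<subseteq> {\<sigma>. \<sigma> permutes (U - {i})}" using A.family i by (rule restr_permutes)
    have "c / 16 * fact m \<le> 1 / (8 * real (card U)) * (c * fact (card U - 1))"
      using A.c_pos unfolding m by (simp add: field_simps)
    also have "\<dots> \<le> freq A i j * real (card A)"
      using f A.dense A.c_pos by (intro mult_mono) auto
    also have "\<dots> = real (card (restr i j A))"
      by (simp add: card_restr card_eq_freq[OF A.finite_A])
    finally show "c / 16 * fact (card (U - {i}) - 1) \<le> real (card (restr i j A))"
      by (simp add: cU)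
  qed
qed

text \<open>In \<open>3 + 128 / c\<close> the cell itself accounts for 1, and the overlap bound for
  the restricted families, at density \<open>c / 16\<close>, for \<open>2 + 128 / c\<close>.\<close>

lemma restr_moment:
  assumes A: "dense_family U c A" and B: "dense_family U c B"
    and ij: "i \<in> U" and n: "2 \<le> card U" and g: "good U A B i j"
  shows "(\<Sum>\<sigma>\<in>{\<sigma> \<in> A. \<sigma> i = j}. \<Sum>\<tau>\<in>{\<tau> \<in> B. \<tau> i = j}. real (agr U \<sigma> \<tau>))
       \<le> real (card A) * real (card B) * ((3 + 128 / c) * (freq A i j * freq B i j))"
proof -
  interpret A: dense_family U c A by fact
  interpret B: dense_family U c B by fact
  interpret A': dense_family "U - {i}" "c / 16" "restr i j A"
    using dense_restr[OF A ij n] g by (simp add: good_def)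
  interpret B': dense_family "U - {i}" "c / 16" "restr i j B"
    using dense_restr[OF B ij n] g by (simp add: good_def)
  have "(\<Sum>\<sigma>\<in>{\<sigma> \<in> A. \<sigma> i = j}. \<Sum>\<tau>\<in>{\<tau> \<in> B. \<tau> i = j}. real (agr U \<sigma> \<tau>))
      = (\<Sum>\<sigma>\<in>restr i j A. \<Sum>\<tau>\<in>restr i j B. 1 + real (agr (U - {i}) \<sigma> \<tau>))"
    using sum_restr[OF A.finite_U ij, where g = real] by simp
  also have "\<dots> = real (card (restr i j A)) * real (card (restr i j B)) * (1 + overlap (U - {i}) (restr i j A) (restr i j B))"
    by (simp add: sum.distrib sum_agr[OF A'.finite_U A'.family B'.family] distrib_left)
  also have "\<dots> \<le> real (card (restr i j A)) * real (card (restr i j B)) * (3 + 128 / c)"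
    using overlap_le[OF A'.dense_family_axioms B'.dense_family_axioms] by (intro mult_left_mono) auto
  finally show ?thesis by (simp add: card_restr card_eq_freq A.finite_A B.finite_A mult_ac)
qed

text \<open>A second-moment argument, free of cross-intersection because it will be applied to
  restricted families that need not have this property. Only agreements at good cells are counted by
  \<open>N\<close>: their mean is still at least \<open>3 / 4 - 1 / 4\<close>, and the product of
  \<open>N\<close> with the full number of agreements has bounded mean, since good cells leave dense
  restrictions.\<close>

lemma intersecting_pairs_positive_proportion:
  assumes c: "0 < c"
  shows "\<exists>\<kappa>>0. \<exists>n0. \<forall>(U :: 'a set) A B. dense_family U c A \<longrightarrow> dense_family U c B \<longrightarrow> n0 \<le> real (card U) \<longrightarrow>
    \<kappa> * (real (card A) * real (card B)) \<le> (\<Sum>\<sigma>\<in>A. \<Sum>\<tau>\<in>B. of_bool (1 \<le> agr U \<sigma> \<tau>))"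
proof -
  from overlap_ge[OF c, where 'a = 'a] obtain n0 where
    n0: "\<And>(U :: 'a set) A B. dense_family U c A \<Longrightarrow> dense_family U c B \<Longrightarrow> n0 \<le> real (card U) \<Longrightarrow>
      3 / 4 \<le> overlap U A B" by blast
  define K where "K = (3 + 128 / c) * (2 + 8 / c)"
  define s where "s = 4 * K"
  have K: "0 < K" using c by (simp add: K_def pos_add_strict)
  have s: "0 < s" using K by (simp add: s_def)
  have "1 / (4 * s) * (real (card A) * real (card B)) \<le> (\<Sum>\<sigma>\<in>A. \<Sum>\<tau>\<in>B. of_bool (1 \<le> agr U \<sigma> \<tau>))"
    if A: "dense_family U c A" and B: "dense_family U c B" and n: "max n0 2 \<le> real (card U)"
    for U :: "'a set" and A B
  proof -
    interpret A: dense_family U c A by fact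
    interpret B: dense_family U c B by fact
    let ?ab = "real (card A) * real (card B)"
    define N where "N \<sigma> \<tau> = (\<Sum>k\<in>{k \<in> U. \<sigma> k = \<tau> k}. of_bool (good U A B k (\<sigma> k)) :: real)" for \<sigma> \<tau>
    have n2: "2 \<le> card U" using n by simp
    have N0: "0 \<le> N \<sigma> \<tau>" for \<sigma> \<tau> by (simp add: N_def sum_nonneg)
    have NN: "N \<sigma> \<tau> \<le> real (agr U \<sigma> \<tau>)" for \<sigma> \<tau>
      unfolding N_def agr_def using A.finite_U sum_mono[of "{k \<in> U. \<sigma> k = \<tau> k}" "\<lambda>k. of_bool (good U A B k (\<sigma> k)) :: real" "\<lambda>_. 1"]
      by simp
    have "(\<Sum>\<sigma>\<in>A. \<Sum>\<tau>\<in>B. N \<sigma> \<tau>)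
        = ?ab * (\<Sum>i\<in>U. \<Sum>j\<in>U. of_bool (good U A B i j) * (freq A i j * freq B i j))"
      unfolding N_def by (rule sum_weighted_agreements[OF A.finite_U A.family B.family])
    also have "\<dots> \<ge> ?ab * (1 / 2)"
      using good_overlap[OF A B] n0[OF A B] n by (intro mult_left_mono) auto
    finally have first: "?ab * (1 / 2) \<le> (\<Sum>\<sigma>\<in>A. \<Sum>\<tau>\<in>B. N \<sigma> \<tau>)" .
    have "(\<Sum>\<sigma>\<in>A. \<Sum>\<tau>\<in>B. N \<sigma> \<tau> * real (agr U \<sigma> \<tau>))
       = (\<Sum>i\<in>U. \<Sum>j\<in>U. of_bool (good U A B i j) *
           (\<Sum>\<sigma>\<in>{\<sigma> \<in> A. \<sigma> i = j}. \<Sum>\<tau>\<in>{\<tau> \<in> B. \<tau> i = j}. real (agr U \<sigma> \<tau>)))"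
      unfolding N_def sum_distrib_right
      by (subst sum_agreements[OF A.finite_U A.family B.family, of "\<lambda>i j \<sigma> \<tau>. of_bool (good U A B i j) * real (agr U \<sigma> \<tau>)"])
         (simp add: sum_distrib_left)
    also have "\<dots> \<le> (\<Sum>i\<in>U. \<Sum>j\<in>U. ?ab * ((3 + 128 / c) * (freq A i j * freq B i j)))"
    proof (intro sum_mono)
      fix i j assume "i \<in> U" "j \<in> U"
      then show "of_bool (good U A B i j) * (\<Sum>\<sigma>\<in>{\<sigma> \<in> A. \<sigma> i = j}. \<Sum>\<tau>\<in>{\<tau> \<in> B. \<tau> i = j}. real (agr U \<sigma> \<tau>))
        \<le> ?ab * ((3 + 128 / c) * (freq A i j * freq B i j))"
        using restr_moment[OF A B _ n2] c by (cases "good U A B i j") auto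
    qed
    also have "\<dots> = ?ab * ((3 + 128 / c) * overlap U A B)"
      by (simp add: overlap_def sum_distrib_left)
    also have "\<dots> \<le> ?ab * K"
      unfolding K_def using overlap_le[OF A B] c by (intro mult_left_mono) auto
    finally have second: "(\<Sum>\<sigma>\<in>A. \<Sum>\<tau>\<in>B. N \<sigma> \<tau> * real (agr U \<sigma> \<tau>)) \<le> ?ab * K" .
    \<comment> \<open>If \<open>N > s\<close>, then the number of agreements exceeds
      \<open>s\<close> as well, so the last term dominates; if nothing agrees, then
      \<open>N = 0\<close>. With \<open>s = 4 K\<close> the last term averages to at most
      \<open>1 / 4\<close>, half of the lower bound for \<open>N\<close>.\<close>
    have pt: "N \<sigma> \<tau> \<le> s * of_bool (1 \<le> agr U \<sigma> \<tau>) + N \<sigma> \<tau> * real (agr U \<sigma> \<tau>) / s" for \<sigma> \<tau>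
    proof (cases "1 \<le> agr U \<sigma> \<tau>")
      case True
      show ?thesis
      proof (cases "N \<sigma> \<tau> \<le> s")
        case True
        moreover have "0 \<le> N \<sigma> \<tau> * real (agr U \<sigma> \<tau>) / s" using N0[of \<sigma> \<tau>] s by simp
        ultimately show ?thesis using \<open>1 \<le> agr U \<sigma> \<tau>\<close> by simp
      next
        case False
        then have "N \<sigma> \<tau> * s \<le> N \<sigma> \<tau> * real (agr U \<sigma> \<tau>)"
          using NN[of \<sigma> \<tau>] N0[of \<sigma> \<tau>] by (intro mult_left_mono) auto
        then have "N \<sigma> \<tau> \<le> N \<sigma> \<tau> * real (agr U \<sigma> \<tau>) / s" using s by (simp add: field_simps)
        then show ?thesis using s by simp
      qed
    next
      case False
      then have "agr U \<sigma> \<tau> = 0" by simp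
      then show ?thesis using NN[of \<sigma> \<tau>] N0[of \<sigma> \<tau>] by simp
    qed
    have "?ab * (1 / 2) \<le> (\<Sum>\<sigma>\<in>A. \<Sum>\<tau>\<in>B. s * of_bool (1 \<le> agr U \<sigma> \<tau>) + N \<sigma> \<tau> * real (agr U \<sigma> \<tau>) / s)"
      using first by (rule order_trans) (intro sum_mono pt)
    also have "\<dots> = s * (\<Sum>\<sigma>\<in>A. \<Sum>\<tau>\<in>B. of_bool (1 \<le> agr U \<sigma> \<tau>))
        + (\<Sum>\<sigma>\<in>A. \<Sum>\<tau>\<in>B. N \<sigma> \<tau> * real (agr U \<sigma> \<tau>)) / s"
      by (simp only: sum.distrib sum_distrib_left sum_divide_distrib)
    also have "(\<Sum>\<sigma>\<in>A. \<Sum>\<tau>\<in>B. N \<sigma> \<tau> * real (agr U \<sigma> \<tau>)) / s \<le> ?ab * K / s"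
      using second s by (intro divide_right_mono) auto
    also have "?ab * K / s = ?ab * (1 / 4)" using K by (simp add: s_def)
    finally show ?thesis using s by (simp add: field_simps)
  qed
  note main = this
  show ?thesis
  proof (intro exI conjI allI impI)
    show "0 < 1 / (4 * s)" using s by simp
  qed (rule main)
qed

lemma cross_intersecting_common_heavy:
  assumes c: "0 < c"
  shows "\<exists>\<epsilon>>0. \<exists>n0. \<forall>(U :: 'a set) A B. dense_family U c A \<longrightarrow> dense_family U c B \<longrightarrow> n0 \<le> real (card U) \<longrightarrow>
    (\<forall>\<sigma>\<in>A. \<forall>\<tau>\<in>B. \<exists>k\<in>U. \<sigma> k = \<tau> k) \<longrightarrow>
    (\<exists>i\<in>U. \<exists>j\<in>U. \<epsilon> \<le> freq A i j \<and> \<epsilon> \<le> freq B i j)"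
proof -
  have "0 < c / 16" using c by simp
  from intersecting_pairs_positive_proportion[OF this, where 'a = 'a] obtain \<kappa> n1 where \<kappa>: "0 < \<kappa>" and
    n1: "\<And>(U :: 'a set) A B. dense_family U (c / 16) A \<Longrightarrow> dense_family U (c / 16) B \<Longrightarrow> n1 \<le> real (card U) \<Longrightarrow>
      \<kappa> * (real (card A) * real (card B)) \<le> (\<Sum>\<sigma>\<in>A. \<Sum>\<tau>\<in>B. of_bool (1 \<le> agr U \<sigma> \<tau>))"
    by blast
  from overlap_ge[OF c, where 'a = 'a] obtain n2 where
    n2: "\<And>(U :: 'a set) A B. dense_family U c A \<Longrightarrow> dense_family U c B \<Longrightarrow> n2 \<le> real (card U) \<Longrightarrow>
      3 / 4 \<le> overlap U A B" by blast
  \<comment> \<open>Double agreements will have weight at least \<open>\<kappa> / 2\<close> and at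
    most \<open>4 \<gamma> = \<kappa> / 4\<close>, which is the contradiction.\<close>
  define \<gamma> where "\<gamma> = \<kappa> / 16"
  have \<gamma>: "0 < \<gamma>" using \<kappa> by (simp add: \<gamma>_def)
  from light_overlap[OF c \<gamma>, where 'a = 'a] obtain \<epsilon>1 n3 where \<epsilon>1: "0 < \<epsilon>1" and
    n3: "\<And>(U :: 'a set) A B. dense_family U c A \<Longrightarrow> dense_family U c B \<Longrightarrow> n3 \<le> real (card U) \<Longrightarrow>
    \<bar>(\<Sum>i\<in>U. \<Sum>j\<in>U. freq B i j * (if freq A i j < \<epsilon>1 then freq A i j else 0))
     - (\<Sum>i\<in>U. \<Sum>j\<in>U. if freq A i j < \<epsilon>1 then freq A i j else 0) / real (card U)\<bar> \<le> \<gamma>"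
    by blast
  define K where "K = 2 + 8 / c"
  \<comment> \<open>If no cell is heavy for both, \<open>\<epsilon> \<le> \<epsilon>1\<close> makes
    \<open>freq B\<close> smaller than \<open>\<epsilon>\<close> wherever \<open>freq A\<close> is
    at least \<open>\<epsilon>1\<close>. The second entry keeps the contribution of these cells, at
    most \<open>\<epsilon> K / \<epsilon>1\<close>, below \<open>\<gamma>\<close>.\<close>
  define \<epsilon> where "\<epsilon> = min \<epsilon>1 (\<gamma> * \<epsilon>1 / K)"
  have K: "0 < K" using c by (simp add: K_def pos_add_strict)
  have \<epsilon>: "0 < \<epsilon>" using \<epsilon>1 \<gamma> K by (simp add: \<epsilon>_def)
  have "\<exists>i\<in>U. \<exists>j\<in>U. \<epsilon> \<le> freq A i j \<and> \<epsilon> \<le> freq B i j"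
    if A: "dense_family U c A" and B: "dense_family U c B"
      \<comment> \<open>The additional 1 makes \<open>n1\<close> applicable on
        \<open>U - {i}\<close>.\<close>
      and n: "max (max n1 n2) (max n3 2) + 1 \<le> real (card U)"
      and cross: "\<forall>\<sigma>\<in>A. \<forall>\<tau>\<in>B. \<exists>k\<in>U. \<sigma> k = \<tau> k"
    for U :: "'a set" and A B
  proof (rule ccontr)
    assume "\<not> (\<exists>i\<in>U. \<exists>j\<in>U. \<epsilon> \<le> freq A i j \<and> \<epsilon> \<le> freq B i j)"
    then have none: "freq A i j < \<epsilon> \<or> freq B i j < \<epsilon>" if "i \<in> U" "j \<in> U" for i j
      using that by (meson not_less)
    interpret A: dense_family U c A by fact
    interpret B: dense_family U c B by fact
    let ?ab = "real (card A) * real (card B)"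
    have ab: "0 < ?ab" using A.card_A_pos B.card_A_pos by simp
    have nn: "2 \<le> card U" using n by simp
    have agr1: "1 \<le> agr U \<sigma> \<tau>" if "\<sigma> \<in> A" "\<tau> \<in> B" for \<sigma> \<tau>
      using cross that A.finite_U by (auto simp: agr_def Suc_le_eq card_gt_0_iff)
    have "overlap U A B \<le> 1 + 2 * \<gamma>"
    proof -
      let ?L = "\<Sum>i\<in>U. \<Sum>j\<in>U. if freq A i j < \<epsilon>1 then freq A i j else 0"
      have "overlap U A B \<le> (\<Sum>i\<in>U. \<Sum>j\<in>U. freq B i j * (if freq A i j < \<epsilon>1 then freq A i j else 0)
           + \<epsilon> * (if freq A i j < \<epsilon>1 then 0 else freq A i j))"
        unfolding overlap_def
      proof (intro sum_mono)
        fix i j assume "i \<in> U" "j \<in> U"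
        then show "freq A i j * freq B i j \<le> freq B i j * (if freq A i j < \<epsilon>1 then freq A i j else 0)
           + \<epsilon> * (if freq A i j < \<epsilon>1 then 0 else freq A i j)"
          using none[of i j] mult_left_mono[of "freq B i j" \<epsilon> "freq A i j"]
          by (auto simp: \<epsilon>_def mult.commute)
      qed
      also have "\<dots> = (\<Sum>i\<in>U. \<Sum>j\<in>U. freq B i j * (if freq A i j < \<epsilon>1 then freq A i j else 0))
          + \<epsilon> * (\<Sum>i\<in>U. \<Sum>j\<in>U. if freq A i j < \<epsilon>1 then 0 else freq A i j)"
        by (simp only: sum.distrib sum_distrib_left)
      also have "(\<Sum>i\<in>U. \<Sum>j\<in>U. freq B i j * (if freq A i j < \<epsilon>1 then freq A i j else 0))
          \<le> ?L / real (card U) + \<gamma>"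
        using n3[OF A B] n by linarith
      also have "?L \<le> (\<Sum>i\<in>U. \<Sum>j\<in>U. freq A i j)" by (intro sum_mono) auto
      also have "\<dots> = real (card U)" by (rule sum_freq[OF A.finite_U A.family A.A_nonempty])
      also have "\<epsilon> * (\<Sum>i\<in>U. \<Sum>j\<in>U. if freq A i j < \<epsilon>1 then 0 else freq A i j) \<le> \<epsilon> * (K / \<epsilon>1)"
        using A.sum_freq_heavy[OF \<epsilon>1] \<epsilon> by (intro mult_left_mono) (auto simp: K_def)
      also have "\<dots> \<le> \<gamma> * \<epsilon>1 / K * (K / \<epsilon>1)"
        using K \<epsilon>1 by (intro mult_right_mono) (auto simp: \<epsilon>_def)
      also have "\<dots> = \<gamma>" using K \<epsilon>1 by simp
      finally show ?thesis using A.card_U_pos by (simp add: divide_right_mono)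
    qed
    then have "(\<Sum>\<sigma>\<in>A. \<Sum>\<tau>\<in>B. real (agr U \<sigma> \<tau>)) \<le> ?ab * (1 + 2 * \<gamma>)"
      unfolding sum_agr[OF A.finite_U A.family B.family] using ab by (intro mult_left_mono) auto
    moreover have "(\<Sum>\<sigma>\<in>A. \<Sum>\<tau>\<in>B. 2 * (real (agr U \<sigma> \<tau>) - 1))
        = 2 * ((\<Sum>\<sigma>\<in>A. \<Sum>\<tau>\<in>B. real (agr U \<sigma> \<tau>)) - ?ab)"
      unfolding sum_distrib_left[symmetric] sum_subtractf by simp
    ultimately have upper: "(\<Sum>\<sigma>\<in>A. \<Sum>\<tau>\<in>B. 2 * (real (agr U \<sigma> \<tau>) - 1)) \<le> ?ab * (4 * \<gamma>)"
      by (simp add: distrib_left)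
    have "1 / 2 \<le> (\<Sum>i\<in>U. \<Sum>j\<in>U. of_bool (good U A B i j) * (freq A i j * freq B i j))"
      using good_overlap[OF A B] n2[OF A B] n by linarith
    then have "?ab * (\<kappa> * (1 / 2)) \<le> ?ab * (\<kappa> * (\<Sum>i\<in>U. \<Sum>j\<in>U. of_bool (good U A B i j) * (freq A i j * freq B i j)))"
      using \<kappa> ab by (intro mult_left_mono) auto
    also have "\<dots> = (\<Sum>i\<in>U. \<Sum>j\<in>U. of_bool (good U A B i j) * (\<kappa> * (?ab * (freq A i j * freq B i j))))"
      by (simp add: sum_distrib_left mult_ac)
    also have "\<dots> \<le> (\<Sum>i\<in>U. \<Sum>j\<in>U. \<Sum>\<sigma>\<in>{\<sigma> \<in> A. \<sigma> i = j}. \<Sum>\<tau>\<in>{\<tau> \<in> B. \<tau> i = j}. of_bool (2 \<le> agr U \<sigma> \<tau>))"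
    proof (intro sum_mono)
      fix i j assume i: "i \<in> U" and j: "j \<in> U"
      show "of_bool (good U A B i j) * (\<kappa> * (?ab * (freq A i j * freq B i j)))
        \<le> (\<Sum>\<sigma>\<in>{\<sigma> \<in> A. \<sigma> i = j}. \<Sum>\<tau>\<in>{\<tau> \<in> B. \<tau> i = j}. of_bool (2 \<le> agr U \<sigma> \<tau>))"
      proof (cases "good U A B i j")
        case True
        have "\<kappa> * (real (card (restr i j A)) * real (card (restr i j B)))
          \<le> (\<Sum>\<sigma>\<in>restr i j A. \<Sum>\<tau>\<in>restr i j B. of_bool (1 \<le> agr (U - {i}) \<sigma> \<tau>))"
          using True n i A.finite_U nn
          by (intro n1 dense_restr[OF A i nn] dense_restr[OF B i nn]) (auto simp: good_def of_nat_diff)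
        also have "\<dots> = (\<Sum>\<sigma>\<in>{\<sigma> \<in> A. \<sigma> i = j}. \<Sum>\<tau>\<in>{\<tau> \<in> B. \<tau> i = j}. of_bool (2 \<le> agr U \<sigma> \<tau>))"
          using sum_restr[OF A.finite_U i, where g = "\<lambda>k. of_bool (2 \<le> k) :: real"] by (simp add: numeral_2_eq_2)
        finally show ?thesis using True
          by (simp add: card_restr card_eq_freq A.finite_A B.finite_A mult_ac)
      qed (simp add: sum_nonneg)
    qed
    also have "\<dots> = (\<Sum>\<sigma>\<in>A. \<Sum>\<tau>\<in>B. \<Sum>k\<in>{k \<in> U. \<sigma> k = \<tau> k}. of_bool (2 \<le> agr U \<sigma> \<tau>))"
      by (rule sum_agreements[OF A.finite_U A.family B.family, symmetric])
    also have "\<dots> = (\<Sum>\<sigma>\<in>A. \<Sum>\<tau>\<in>B. real (agr U \<sigma> \<tau>) * of_bool (2 \<le> agr U \<sigma> \<tau>))"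
      by (simp add: agr_def)
    \<comment> \<open>For \<open>N \<ge> 2\<close> agreements \<open>N \<le> 2 (N - 1)\<close>, and
      for \<open>N = 1\<close> both sides vanish. Cross-intersection enters here by excluding
      \<open>N = 0\<close>, where the right-hand side would be negative.\<close>
    also have "\<dots> \<le> (\<Sum>\<sigma>\<in>A. \<Sum>\<tau>\<in>B. 2 * (real (agr U \<sigma> \<tau>) - 1))"
    proof (intro sum_mono)
      fix \<sigma> \<tau> assume "\<sigma> \<in> A" "\<tau> \<in> B"
      then show "real (agr U \<sigma> \<tau>) * of_bool (2 \<le> agr U \<sigma> \<tau>) \<le> 2 * (real (agr U \<sigma> \<tau>) - 1)"
        using agr1[of \<sigma> \<tau>] by (cases "2 \<le> agr U \<sigma> \<tau>") auto
    qed
    also note upper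
    finally have "\<kappa> * (1 / 2) \<le> 4 * \<gamma>" using ab by (simp only: mult_le_cancel_left_pos)
    then show False using \<kappa> by (simp add: \<gamma>_def)
  qed
  note main = this
  show ?thesis
  proof (intro exI conjI allI impI)
    show "0 < \<epsilon>" by fact
  qed (rule main)
qed

subsection \<open>Permutations avoiding two given ones\<close>

definition hits :: "'a set \<Rightarrow> ('a \<Rightarrow> 'b) \<Rightarrow> ('a \<Rightarrow> 'b) \<Rightarrow> ('a \<Rightarrow> 'b) \<Rightarrow> 'a set" where
  "hits U x y \<sigma> = {k \<in> U. \<sigma> k = x k \<or> \<sigma> k = y k}"

definition hit_level :: "'a set \<Rightarrow> ('a \<Rightarrow> 'a) \<Rightarrow> ('a \<Rightarrow> 'a) \<Rightarrow> nat \<Rightarrow> ('a \<Rightarrow> 'a) set" where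
  "hit_level U x y k = {\<sigma>. \<sigma> permutes U \<and> card (hits U x y \<sigma>) = k}"

lemma card_le_one_of_inj:
  assumes "inj_on f U"
  shows "card {s \<in> U. f s = a} \<le> 1"
proof -
  define S where "S = {s \<in> U. f s = a}"
  have "s = t" if "s \<in> S" "t \<in> S" for s t
    using that inj_onD[OF assms] by (simp add: S_def)
  then have "S = {} \<or> (\<exists>t. S = {t})" by blast
  then have "card S \<le> 1" by auto
  then show ?thesis by (simp add: S_def)
qed

text \<open>Exchanging the values at \<open>r\<close> and \<open>s\<close> can create a hit in four
  ways, with \<open>x\<close> or \<open>y\<close>, at \<open>r\<close> or \<open>s\<close>. By
  injectivity each way rules out at most one \<open>s\<close>, in addition to the \<open>k\<close>
  present hits.\<close>

lemma switching_targets: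
  assumes U: "finite U" and x: "inj_on x U" and y: "inj_on y U"
    and \<sigma>: "\<sigma> permutes U" and k: "card (hits U x y \<sigma>) = k"
  shows "card U - k - 4 \<le> card {s \<in> U. s \<notin> hits U x y \<sigma> \<and> \<sigma> s \<noteq> x r \<and> \<sigma> s \<noteq> y r \<and> \<sigma> r \<noteq> x s \<and> \<sigma> r \<noteq> y s}"
    (is "_ \<le> card ?T")
proof -
  let ?E = "hits U x y \<sigma> \<union> {s \<in> U. \<sigma> s = x r} \<union> {s \<in> U. \<sigma> s = y r} \<union> {s \<in> U. x s = \<sigma> r} \<union> {s \<in> U. y s = \<sigma> r}"
  have inj: "inj_on \<sigma> U" using \<sigma> by (rule permutes_inj_on)
  have "card ?E \<le> k + 1 + 1 + 1 + 1"
    using k card_le_one_of_inj[OF inj] card_le_one_of_inj[OF x] card_le_one_of_inj[OF y]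
    by (intro order_trans[OF card_Un_le] add_mono) auto
  moreover have "finite ?E" using U by (auto simp: hits_def)
  ultimately have "card U - k - 4 \<le> card (U - ?E)"
    using diff_card_le_card_Diff[of ?E U] by linarith
  also have "U - ?E \<subseteq> ?T" by auto
  then have "card (U - ?E) \<le> card ?T" using U by (intro card_mono) auto
  finally show ?thesis .
qed

text \<open>Double counting of the exchanges that destroy exactly one hit \<open>r\<close>. Forward
  there are \<open>Suc k\<close> choices of \<open>r\<close> and many of \<open>s\<close>; backward,
  \<open>s\<close> is determined by \<open>r\<close> and by which of \<open>x r\<close>,
  \<open>y r\<close> was the value, hence \<open>2 * card U\<close>.\<close>

lemma switching:
  assumes U: "finite U" and x: "inj_on x U" and y: "inj_on y U"
  shows "Suc k * (card U - Suc k - 4) * card (hit_level U x y (Suc k)) \<le> 2 * card U * card (hit_level U x y k)"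
proof -
  let ?T = "\<lambda>\<sigma> r. {s \<in> U. s \<notin> hits U x y \<sigma> \<and> \<sigma> s \<noteq> x r \<and> \<sigma> s \<noteq> y r \<and> \<sigma> r \<noteq> x s \<and> \<sigma> r \<noteq> y s}"
  let ?src = "SIGMA \<sigma>:hit_level U x y (Suc k). SIGMA r:hits U x y \<sigma>. ?T \<sigma> r"
  let ?dst = "SIGMA \<sigma>:hit_level U x y k. {(r, s). r \<in> U \<and> s \<in> U \<and> (\<sigma> s = x r \<or> \<sigma> s = y r)}"
  have fin: "finite (hit_level U x y k)" for k
    using finite_permutations[OF U] by (rule rev_finite_subset) (auto simp: hit_level_def)
  have fh: "finite (hits U x y \<sigma>)" for \<sigma> using U by (simp add: hits_def)
  have "Suc k * (card U - Suc k - 4) * card (hit_level U x y (Suc k))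
      = (\<Sum>\<sigma>\<in>hit_level U x y (Suc k). \<Sum>r\<in>hits U x y \<sigma>. card U - Suc k - 4)"
    by (simp add: hit_level_def)
  also have "\<dots> \<le> (\<Sum>\<sigma>\<in>hit_level U x y (Suc k). \<Sum>r\<in>hits U x y \<sigma>. card (?T \<sigma> r))"
    by (intro sum_mono switching_targets U x y) (auto simp: hit_level_def)
  also have "\<dots> = card ?src"
    using U fin fh by (subst card_SigmaI; (subst card_SigmaI)?) auto
  also have "\<dots> \<le> card ?dst"
  proof (rule card_inj_on_le)
    let ?f = "\<lambda>(\<sigma>, r, s). (\<sigma> \<circ> transpose r s, r, s)"
    show "inj_on ?f ?src"
    proof (rule inj_onI)
      fix p q :: "('a \<Rightarrow> 'a) \<times> 'a \<times> 'a" assume eq: "?f p = ?f q"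
      obtain \<sigma> r s \<sigma>' where p: "p = (\<sigma>, r, s)" and q: "q = (\<sigma>', r, s)"
        using eq by (cases p; cases q) auto
      have "\<sigma> \<circ> transpose r s = \<sigma>' \<circ> transpose r s" using eq by (simp add: p q)
      then have "\<sigma> \<circ> transpose r s \<circ> transpose r s = \<sigma>' \<circ> transpose r s \<circ> transpose r s" by simp
      then show "p = q" by (simp add: p q o_assoc[symmetric])
    qed
    show "?f ` ?src \<subseteq> ?dst"
    proof (rule image_subsetI)
      fix p assume "p \<in> ?src"
      then obtain \<sigma> r s where p: "p = (\<sigma>, r, s)"
        and \<sigma>: "\<sigma> \<in> hit_level U x y (Suc k)" and r: "r \<in> hits U x y \<sigma>" and s: "s \<in> U"
        "s \<notin> hits U x y \<sigma>" "\<sigma> s \<noteq> x r" "\<sigma> s \<noteq> y r" "\<sigma> r \<noteq> x s" "\<sigma> r \<noteq> y s"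
        by auto
      have rU: "r \<in> U" and rx: "\<sigma> r = x r \<or> \<sigma> r = y r" using r by (auto simp: hits_def)
      have "hits U x y (\<sigma> \<circ> transpose r s) = hits U x y \<sigma> - {r}"
        using s rU by (auto simp: hits_def transpose_def)
      then have "card (hits U x y (\<sigma> \<circ> transpose r s)) = k"
        using \<sigma> r fh by (simp add: hit_level_def)
      moreover have "\<sigma> \<circ> transpose r s permutes U"
        using \<sigma> rU s by (intro permutes_compose permutes_swap_id) (auto simp: hit_level_def)
      ultimately show "?f p \<in> ?dst"
        using rU s rx by (auto simp: hit_level_def p)
    qed
    show "finite ?dst"
    proof (rule finite_SigmaI[OF fin])
      fix \<sigma> show "finite {(r, s). r \<in> U \<and> s \<in> U \<and> (\<sigma> s = x r \<or> \<sigma> s = y r)}"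
        by (rule finite_subset[OF _ finite_cartesian_product[OF U U]]) auto
    qed
  qed
  also have "\<dots> = (\<Sum>\<sigma>\<in>hit_level U x y k. card {(r, s). r \<in> U \<and> s \<in> U \<and> (\<sigma> s = x r \<or> \<sigma> s = y r)})"
    by (rule card_SigmaI[OF fin]) (auto intro: finite_subset[OF _ finite_cartesian_product[OF U U]])
  also have "\<dots> \<le> (\<Sum>\<sigma>\<in>hit_level U x y k. 2 * card U)"
  proof (rule sum_mono)
    fix \<sigma> assume "\<sigma> \<in> hit_level U x y k"
    then have \<sigma>: "\<sigma> permutes U" by (simp add: hit_level_def)
    have "{(r, s). r \<in> U \<and> s \<in> U \<and> (\<sigma> s = x r \<or> \<sigma> s = y r)}
        \<subseteq> (\<lambda>r. (r, inv \<sigma> (x r))) ` U \<union> (\<lambda>r. (r, inv \<sigma> (y r))) ` U"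
    proof
      fix p assume "p \<in> {(r, s). r \<in> U \<and> s \<in> U \<and> (\<sigma> s = x r \<or> \<sigma> s = y r)}"
      then obtain r s where p: "p = (r, s)" "r \<in> U" and "\<sigma> s = x r \<or> \<sigma> s = y r" by auto
      then have "s = inv \<sigma> (x r) \<or> s = inv \<sigma> (y r)"
        using permutes_inverses(2)[OF \<sigma>, of s] by auto
      then show "p \<in> (\<lambda>r. (r, inv \<sigma> (x r))) ` U \<union> (\<lambda>r. (r, inv \<sigma> (y r))) ` U"
        using p by auto
    qed
    then have "card {(r, s). r \<in> U \<and> s \<in> U \<and> (\<sigma> s = x r \<or> \<sigma> s = y r)}
        \<le> card ((\<lambda>r. (r, inv \<sigma> (x r))) ` U \<union> (\<lambda>r. (r, inv \<sigma> (y r))) ` U)"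
      using U by (intro card_mono) auto
    also have "\<dots> \<le> card U + card U"
      by (intro order_trans[OF card_Un_le] add_mono card_image_le U)
    finally show "card {(r, s). r \<in> U \<and> s \<in> U \<and> (\<sigma> s = x r \<or> \<sigma> s = y r)} \<le> 2 * card U" by simp
  qed
  finally show ?thesis by (simp add: mult.commute)
qed

lemma sum_card_hits:
  assumes U: "finite U" "U \<noteq> {}"
  shows "(\<Sum>\<sigma>\<in>{\<sigma>. \<sigma> permutes U}. real (card (hits U x y \<sigma>))) \<le> 2 * fact (card U)"
proof -
  let ?w = "\<lambda>i j. of_bool (j = x i) + of_bool (j = y i) :: real"
  have n: "0 < real (card U)" using U by (simp add: card_gt_0_iff)
  have "real (card (hits U x y \<sigma>)) \<le> permsum U ?w \<sigma>" for \<sigma>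
  proof -
    have "real (card (hits U x y \<sigma>)) = (\<Sum>k\<in>{k \<in> U. \<sigma> k = x k \<or> \<sigma> k = y k}. 1)"
      by (simp add: hits_def)
    also have "\<dots> = (\<Sum>k\<in>U. if \<sigma> k = x k \<or> \<sigma> k = y k then 1 else 0)"
      by (rule sum.inter_filter[OF U(1)])
    also have "\<dots> \<le> permsum U ?w \<sigma>" unfolding permsum_def by (intro sum_mono) auto
    finally show ?thesis .
  qed
  then have "(\<Sum>\<sigma>\<in>{\<sigma>. \<sigma> permutes U}. real (card (hits U x y \<sigma>))) \<le> (\<Sum>\<sigma>\<in>{\<sigma>. \<sigma> permutes U}. permsum U ?w \<sigma>)"
    by (intro sum_mono)
  also have "\<dots> = fact (card U) * (\<Sum>i\<in>U. \<Sum>j\<in>U. ?w i j) / real (card U)"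
    by (rule permsum_mean[OF U])
  also have "\<dots> \<le> fact (card U) * (\<Sum>i\<in>U. 2) / real (card U)"
  proof (intro divide_right_mono mult_left_mono sum_mono)
    fix i
    have "(\<Sum>j\<in>U. of_bool (j = z) :: real) \<le> 1" for z
      using U by (cases "z \<in> U") (auto simp: of_bool_def)
    from add_mono[OF this[of "x i"] this[of "y i"]]
    show "(\<Sum>j\<in>U. ?w i j) \<le> 2" by (simp add: sum.distrib)
  qed auto
  also have "\<dots> = 2 * fact (card U)" using n by simp
  finally show ?thesis .
qed

text \<open>By Markov's inequality at least half of the permutations have at most three hits.
  Switching gives \<open>N 1 \<le> 3 N 0\<close>, \<open>N 2 \<le> 2 N 1\<close> and
  \<open>N 3 \<le> N 2\<close>, so these levels total at most \<open>(1 + 3 + 6 + 6) N 0\<close>.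
  The last comparison is the one that needs 21 points. The maps \<open>x\<close> and
  \<open>y\<close> are mere injections because they will be permutations pulled back to a subset
  that they need not preserve.\<close>

lemma permutes_avoiding_two:
  assumes U: "finite U" and x: "inj_on x U" and y: "inj_on y U" and n: "21 \<le> card U"
  shows "fact (card U) \<le> 32 * real (card {\<sigma>. \<sigma> permutes U \<and> (\<forall>k\<in>U. \<sigma> k \<noteq> x k \<and> \<sigma> k \<noteq> y k)})"
proof -
  let ?P = "{\<sigma>. \<sigma> permutes U}"
  define N where "N k = card (hit_level U x y k)" for k
  have fP: "finite ?P" using finite_permutations[OF U] .
  have cP: "card ?P = fact (card U)" using card_permutations[OF refl U] .
  have Une: "U \<noteq> {}" using n by auto
  have "4 * (real (card ?P) - (real (N 0) + real (N 1) + real (N 2) + real (N 3)))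
      = (\<Sum>\<sigma>\<in>?P. 4 * (1 - (of_bool (card (hits U x y \<sigma>) = 0) + of_bool (card (hits U x y \<sigma>) = 1)
           + of_bool (card (hits U x y \<sigma>) = 2) + of_bool (card (hits U x y \<sigma>) = 3))))"
    using fP by (simp add: sum_distrib_left[symmetric] sum_subtractf sum.distrib N_def hit_level_def Int_def)
  also have "\<dots> \<le> (\<Sum>\<sigma>\<in>?P. real (card (hits U x y \<sigma>)))"
    by (intro sum_mono) (auto simp: of_bool_def)
  also have "\<dots> \<le> 2 * fact (card U)" by (rule sum_card_hits[OF U Une])
  finally have half: "fact (card U) \<le> 2 * (real (N 0) + real (N 1) + real (N 2) + real (N 3))"
    by (simp add: cP)
  have sw: "real (Suc k) * (real (card U) - real k - 5) * real (N (Suc k)) \<le> 2 * real (card U) * real (N k)"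
    if "k < 3" for k
  proof -
    have "real (Suc k * (card U - Suc k - 4) * N (Suc k)) \<le> real (2 * card U * N k)"
      unfolding N_def of_nat_le_iff by (rule switching[OF U x y])
    moreover have "real (card U - Suc k - 4) = real (card U) - real k - 5" using that n by simp
    ultimately show ?thesis by (simp only: of_nat_mult of_nat_numeral)
  qed
  have step: "real (N (Suc k)) \<le> c * real (N k)"
    if k: "k < 3" and c: "2 * real (card U) \<le> c * (real (Suc k) * (real (card U) - real k - 5))" for k c
  proof -
    have pos: "0 < real (Suc k) * (real (card U) - real k - 5)" using k n by simp
    have "real (Suc k) * (real (card U) - real k - 5) * real (N (Suc k)) \<le> 2 * real (card U) * real (N k)"
      by (rule sw[OF k])
    also have "\<dots> \<le> c * (real (Suc k) * (real (card U) - real k - 5)) * real (N k)"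
      using c by (intro mult_right_mono) auto
    also have "\<dots> = real (Suc k) * (real (card U) - real k - 5) * (c * real (N k))"
      by (simp only: mult_ac)
    finally show ?thesis using pos by (simp only: mult_le_cancel_left_pos)
  qed
  have "real (N 1) \<le> 3 * real (N 0)" using step[of 0 3] n by simp
  moreover have "real (N 2) \<le> 2 * real (N 1)" using step[of 1 2] n by (simp add: numeral_2_eq_2)
  moreover have "real (N 3) \<le> real (N 2)" using step[of 2 1] n by (simp add: numeral_3_eq_3)
  ultimately have "fact (card U) \<le> 32 * real (N 0)" using half by argo
  also have "hit_level U x y 0 = {\<sigma>. \<sigma> permutes U \<and> (\<forall>k\<in>U. \<sigma> k \<noteq> x k \<and> \<sigma> k \<noteq> y k)}"
    using U by (auto simp: hit_level_def hits_def)
  then have "N 0 = card {\<sigma>. \<sigma> permutes U \<and> (\<forall>k\<in>U. \<sigma> k \<noteq> x k \<and> \<sigma> k \<noteq> y k)}" by (simp add: N_def)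
  finally show ?thesis .
qed

section \<open>Permutations of a 1-coset that avoid one outside permutation and meet another\<close>

text \<open>Prescribing the only point of agreement with \<open>x\<close> makes the sets for
  different \<open>r\<close> disjoint, so their sizes can be added. The point \<open>i\<close> is
  exempt because its value is already fixed.\<close>

definition exact_hit :: "'a set \<Rightarrow> 'a \<Rightarrow> 'a \<Rightarrow> ('a \<Rightarrow> 'a) \<Rightarrow> ('a \<Rightarrow> 'a) \<Rightarrow> 'a \<Rightarrow> ('a \<Rightarrow> 'a) set" where
  "exact_hit U i j x y r = {\<sigma>. \<sigma> permutes U \<and> \<sigma> i = j \<and> \<sigma> r = x r \<and> (\<forall>k\<in>U - {i, r}. \<sigma> k \<noteq> x k \<and> \<sigma> k \<noteq> y k)}"

text \<open>Some \<open>\<theta>\<close> takes both prescribed values; composing with its inverse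
  leaves permutations of the other \<open>card U - 2\<close> points that avoid two injections. Hence
  23 = 21 + 2.\<close>

lemma card_exact_hit:
  assumes U: "finite U" and ir: "i \<in> U" "r \<in> U" "i \<noteq> r" and j: "j \<in> U" "x r \<noteq> j"
    and x: "x permutes U" and y: "y permutes U" and n: "23 \<le> card U"
  shows "fact (card U - 2) \<le> 32 * real (card (exact_hit U i j x y r))"
proof -
  let ?W = "U - {i, r}"
  \<comment> \<open>The point that \<open>transpose i j\<close> sends to \<open>x r\<close>. It
    differs from \<open>i\<close> since \<open>x r \<noteq> j\<close>, so
    \<open>transpose r s1\<close> fixes \<open>i\<close> and both values of \<open>\<theta>\<close>
    come out right.\<close>
  define s1 where "s1 = transpose i j (x r)"
  define \<theta> where "\<theta> = transpose i j \<circ> transpose r s1"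
  have xr: "x r \<in> U" using permutes_in_image[OF x] ir by simp
  have s1: "s1 \<in> U" "s1 \<noteq> i" using xr ir j by (auto simp: s1_def transpose_def)
  have \<theta>: "\<theta> permutes U" unfolding \<theta>_def using ir j s1 by (intro permutes_compose permutes_swap_id)
  have \<theta>i: "\<theta> i = j" and \<theta>r: "\<theta> r = x r"
    using ir s1 by (auto simp: \<theta>_def s1_def transpose_apply_other)
  have cW: "card ?W = card U - 2" using U ir by (simp add: card_Diff_subset)
  have "inj (inv \<theta> \<circ> z)" if "z permutes U" for z
    using permutes_inj[OF permutes_inv[OF \<theta>]] permutes_inj[OF that] by (rule inj_compose)
  then have inj: "inj_on (inv \<theta> \<circ> z) ?W" if "z permutes U" for z
    using that inj_on_subset by blast
  have "fact (card ?W) \<le> 32 * real (card {\<sigma>. \<sigma> permutes ?W \<and> (\<forall>k\<in>?W. \<sigma> k \<noteq> (inv \<theta> \<circ> x) k \<and> \<sigma> k \<noteq> (inv \<theta> \<circ> y) k)})"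
    (is "_ \<le> 32 * real (card ?S)")
    using U n cW by (intro permutes_avoiding_two inj x y) auto
  also have "card ?S \<le> card (exact_hit U i j x y r)"
  proof (rule card_inj_on_le)
    show "inj_on (\<lambda>\<sigma>. \<theta> \<circ> \<sigma>) ?S"
    proof (rule inj_onI)
      fix \<sigma> \<tau> assume eq: "\<theta> \<circ> \<sigma> = \<theta> \<circ> \<tau>"
      show "\<sigma> = \<tau>"
      proof
        fix k
        from fun_cong[OF eq, of k] have "\<theta> (\<sigma> k) = \<theta> (\<tau> k)" by simp
        then show "\<sigma> k = \<tau> k" by (rule injD[OF permutes_inj[OF \<theta>]])
      qed
    qed
    show "(\<lambda>\<sigma>. \<theta> \<circ> \<sigma>) ` ?S \<subseteq> exact_hit U i j x y r"
    proof clarify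
      fix \<sigma> assume \<sigma>: "\<sigma> permutes ?W" and av: "\<forall>k\<in>?W. \<sigma> k \<noteq> (inv \<theta> \<circ> x) k \<and> \<sigma> k \<noteq> (inv \<theta> \<circ> y) k"
      have "\<sigma> permutes U" using \<sigma> by (rule permutes_subset) auto
      moreover have "\<sigma> i = i" "\<sigma> r = r" using permutes_not_in[OF \<sigma>] by auto
      moreover have "\<theta> (\<sigma> k) \<noteq> z k" if "\<sigma> k \<noteq> (inv \<theta> \<circ> z) k" for z :: "'a \<Rightarrow> 'a" and k
        using that permutes_inverses(2)[OF \<theta>, of "\<sigma> k"] by auto
      ultimately show "\<theta> \<circ> \<sigma> \<in> exact_hit U i j x y r"
        using av \<theta> \<theta>i \<theta>r by (auto simp: exact_hit_def intro: permutes_compose)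
    qed
    show "finite (exact_hit U i j x y r)"
      using finite_permutations[OF U] by (rule rev_finite_subset) (auto simp: exact_hit_def)
  qed
  finally show ?thesis by (simp add: cW)
qed

lemma card_UN_exact_hit:
  assumes U: "finite U" and i: "i \<in> U" and j: "j \<in> U"
    and x: "x permutes U" and y: "y permutes U" and n: "23 \<le> card U"
    and R: "R \<subseteq> {r \<in> U. r \<noteq> i \<and> x r \<noteq> j}"
  shows "real (card R) * fact (card U - 2) \<le> 32 * real (card (\<Union>r\<in>R. exact_hit U i j x y r))"
proof -
  have fR: "finite R" by (rule finite_subset[OF R]) (use U in simp)
  have fin: "finite (exact_hit U i j x y r)" for r
    using finite_permutations[OF U] by (rule rev_finite_subset) (auto simp: exact_hit_def)
  have "exact_hit U i j x y r \<inter> exact_hit U i j x y s = {}" if "r \<in> R" "s \<in> R" "r \<noteq> s" for r s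
    using that R by (auto simp: exact_hit_def)
  then have "real (card (\<Union>r\<in>R. exact_hit U i j x y r)) = (\<Sum>r\<in>R. real (card (exact_hit U i j x y r)))"
    using fR fin by (subst card_UN_disjoint) auto
  moreover have "(\<Sum>r\<in>R. fact (card U - 2)) \<le> (\<Sum>r\<in>R. 32 * real (card (exact_hit U i j x y r)))"
    using R by (intro sum_mono card_exact_hit U i j x y n) auto
  ultimately show ?thesis by (simp add: sum_distrib_left)
qed

definition coset_disjoint :: "'a set \<Rightarrow> 'a \<Rightarrow> 'a \<Rightarrow> ('a \<Rightarrow> 'a) \<Rightarrow> ('a \<Rightarrow> 'a) set" where
  "coset_disjoint U i j x = {\<sigma>. \<sigma> permutes U \<and> \<sigma> i = j \<and> (\<forall>k\<in>U. \<sigma> k \<noteq> x k)}"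

lemma finite_coset_disjoint: "finite U \<Longrightarrow> finite (coset_disjoint U i j x)"
  using finite_permutations by (rule rev_finite_subset) (auto simp: coset_disjoint_def)

text \<open>A permutation that meets \<open>x\<close> only at \<open>r\<close> still avoids
  \<open>y\<close> when \<open>x r \<noteq> y r\<close>. At \<open>i\<close> it avoids both, its
  value there being \<open>j\<close>.\<close>

lemma card_coset_disjoint_Diff:
  assumes U: "finite U" and ij: "i \<in> U" "j \<in> U" and x: "x permutes U" "x i \<noteq> j"
    and y: "y permutes U" "y i \<noteq> j" and n: "23 \<le> card U"
  shows "real (card {r \<in> U. r \<noteq> i \<and> x r \<noteq> j \<and> x r \<noteq> y r}) * fact (card U - 2)
     \<le> 32 * real (card (coset_disjoint U i j y - coset_disjoint U i j x))"
proof -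
  let ?R = "{r \<in> U. r \<noteq> i \<and> x r \<noteq> j \<and> x r \<noteq> y r}"
  have "real (card ?R) * fact (card U - 2) \<le> 32 * real (card (\<Union>r\<in>?R. exact_hit U i j x y r))"
    using assms by (intro card_UN_exact_hit) auto
  also have "card (\<Union>r\<in>?R. exact_hit U i j x y r) \<le> card (coset_disjoint U i j y - coset_disjoint U i j x)"
    using ij x y finite_coset_disjoint[OF U, of i j y]
    by (intro card_mono) (auto simp: exact_hit_def coset_disjoint_def)
  finally show ?thesis by simp
qed

text \<open>Disagreements are useless only at \<open>i\<close> and at the preimage of
  \<open>j\<close> under \<open>x\<close>, hence the 2. Permutations that differ at no other place
  would have to exchange their values at these two, which would give \<open>y i = j\<close>.\<close>

lemma card_disagreement:
  assumes U: "finite U" and i: "i \<in> U" and x: "x permutes U" and y: "y permutes U" "y i \<noteq> j"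
  shows "card U \<le> agr U x y + card {r \<in> U. r \<noteq> i \<and> x r \<noteq> j \<and> x r \<noteq> y r} + 2"
    and "x \<noteq> y \<Longrightarrow> {r \<in> U. r \<noteq> i \<and> x r \<noteq> j \<and> x r \<noteq> y r} \<noteq> {}"
proof -
  let ?R = "{r \<in> U. r \<noteq> i \<and> x r \<noteq> j \<and> x r \<noteq> y r}"
  have "U \<subseteq> {k \<in> U. x k = y k} \<union> ?R \<union> {i} \<union> {r \<in> U. x r = j}" by auto
  then have "card U \<le> card ({k \<in> U. x k = y k} \<union> ?R \<union> {i} \<union> {r \<in> U. x r = j})"
    using U i by (intro card_mono) auto
  also have "\<dots> \<le> agr U x y + card ?R + 1 + 1"
    unfolding agr_def using card_le_one_of_inj[OF permutes_inj_on[OF x]]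
    by (intro order_trans[OF card_Un_le] add_mono) auto
  finally show "card U \<le> agr U x y + card ?R + 2" by simp
  show "?R \<noteq> {}" if ne: "x \<noteq> y"
  proof
    assume empty: "?R = {}"
    obtain p where p: "p \<in> U" "x p \<noteq> y p"
      using ne permutes_not_in[OF x] permutes_not_in[OF y(1)] by (metis ext)
    define q where "q = inv y (x p)"
    have yq: "y q = x p" using permutes_inverses(1)[OF y(1)] by (simp add: q_def)
    have qU: "q \<in> U" using permutes_in_image[OF permutes_inv[OF y(1)]] permutes_in_image[OF x] p by (simp add: q_def)
    have qp: "q \<noteq> p" using yq p by auto
    have xq: "x q \<noteq> y q" using yq qp injD[OF permutes_inj[OF x]] by metis
    have two: "r = i \<or> x r = j" if "r \<in> U" "x r \<noteq> y r" for r
      using empty that by blast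
    show False
    proof (cases "x p = j")
      case True
      then have "q \<noteq> i" using yq y(2) by auto
      then have "x q = j" using two[OF qU xq] by simp
      then show False using True qp injD[OF permutes_inj[OF x]] by metis
    next
      case False
      then have pi: "p = i" using two[OF p] by simp
      define l where "l = inv x (y i)"
      have xl: "x l = y i" using permutes_inverses(1)[OF x] by (simp add: l_def)
      have lU: "l \<in> U" using permutes_in_image[OF permutes_inv[OF x]] permutes_in_image[OF y(1)] i by (simp add: l_def)
      have li: "l \<noteq> i" using xl p pi by auto
      then have "x l \<noteq> y l" using xl injD[OF permutes_inj[OF y(1)]] by metis
      then have "x l = j" using two[OF lU] li by simp
      then show False using xl y(2) by simp
    qed
  qed
qed

text \<open>The number of agreements minus 1 is \<open>permdev\<close> for the graph of
  \<open>x\<close>, with \<open>V = n\<close>, so its fourth powers sum to at most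
  \<open>(18 + 36) n!\<close>. The deviation in question is at least
  \<open>n / 2 - 1 \<ge> n / 4\<close>, which leaves \<open>256 * 54 / n ^ 2\<close> times
  \<open>(n-2)!\<close>, and 1000 points are ample. The second moment bound would only give about
  \<open>32 (n-2)!\<close>.\<close>

lemma card_agr_large:
  assumes U: "finite U" and x: "x permutes U" and n: "1000 \<le> card U"
  shows "32 * real (card {y. y permutes U \<and> real (card U) / 2 \<le> real (agr U x y)}) < fact (card U - 2)"
proof -
  let ?S = "{y. y permutes U \<and> real (card U) / 2 \<le> real (agr U x y)}"
  let ?n = "real (card U)"
  let ?w = "\<lambda>i j. of_bool (j = x i) :: real"
  have Une: "U \<noteq> {}" using n by auto
  have nn: "1000 \<le> ?n" using n by simp
  have fP: "finite {y. y permutes U}" using finite_permutations[OF U] .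
  have one: "(\<Sum>j\<in>U. ?w i j) = 1" if "i \<in> U" for i
    using U permutes_in_image[OF x] that by (simp add: of_bool_def)
  have dev: "permdev U ?w y = real (agr U x y) - 1" for y
  proof -
    have "{i \<in> U. y i = x i} = {k \<in> U. x k = y k}" by auto
    then have "permsum U ?w y = real (agr U x y)" using U by (simp add: permsum_def agr_def Int_def)
    moreover have "(\<Sum>i\<in>U. \<Sum>j\<in>U. ?w i j) = (\<Sum>i\<in>U. 1)" by (rule sum.cong[OF refl one])
    ultimately show ?thesis unfolding permdev_def using nn by simp
  qed
  have "(\<Sum>y\<in>{y. y permutes U}. (permdev U ?w y) ^ 4) \<le> fact (card U) * (18 * 1\<^sup>2 * (\<Sum>i\<in>U. \<Sum>j\<in>U. (?w i j)\<^sup>2) / ?n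
       + 36 * (\<Sum>i\<in>U. \<Sum>j\<in>U. (?w i j)\<^sup>2)\<^sup>2 / ?n\<^sup>2)"
    by (rule permdev_fourth_moment[OF U Une]) auto
  also have "(\<Sum>i\<in>U. \<Sum>j\<in>U. (?w i j)\<^sup>2) = ?n"
    by (simp add: of_bool_def if_distrib[of "\<lambda>x. x\<^sup>2"] one[unfolded of_bool_def] cong: if_cong)
  finally have four: "(\<Sum>y\<in>{y. y permutes U}. (permdev U ?w y) ^ 4) \<le> fact (card U) * 54"
    using nn by simp
  have "real (card ?S) * (?n / 4) ^ 4 = (\<Sum>y\<in>?S. (?n / 4) ^ 4)" by simp
  also have "\<dots> \<le> (\<Sum>y\<in>?S. (permdev U ?w y) ^ 4)"
    using nn by (intro sum_mono power_mono) (auto simp: dev)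
  also have "\<dots> \<le> (\<Sum>y\<in>{y. y permutes U}. (permdev U ?w y) ^ 4)"
    using fP by (intro sum_mono2) auto
  also note four
  also have "(fact (card U) :: real) = ?n * ((?n - 1) * fact (card U - 2))"
  proof -
    define m where "m = card U - 2"
    have "card U = Suc (Suc m)" using n by (simp add: m_def)
    then show ?thesis by simp
  qed
  also have "\<dots> * 54 \<le> ?n\<^sup>2 * 54 * fact (card U - 2)"
    using nn by (simp add: power2_eq_square)
  finally have "?n\<^sup>2 * (real (card ?S) * ?n\<^sup>2) \<le> ?n\<^sup>2 * (256 * 54 * fact (card U - 2))"
    by (simp add: power_divide power4_eq_xxxx power2_eq_square mult_ac)
  then have "real (card ?S) * ?n\<^sup>2 \<le> 256 * 54 * fact (card U - 2)"
    using nn by (subst (asm) mult_le_cancel_left_pos) auto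
  moreover have "real (card ?S) * 1000\<^sup>2 \<le> real (card ?S) * ?n\<^sup>2"
    using nn by (intro mult_left_mono power_mono) auto
  ultimately have "real (card ?S) * 1000000 \<le> 13824 * fact (card U - 2)" by simp
  moreover have "0 < (fact (card U - 2) :: real)" by simp
  ultimately show ?thesis by linarith
qed

subsection \<open>The extremal configuration\<close>

lemma finite_permutes_Collect: "finite U \<Longrightarrow> finite {\<sigma>. \<sigma> permutes U \<and> P \<sigma>}"
  using finite_permutations by (rule rev_finite_subset) auto

lemma permutes_Diff_fixed: "p permutes U \<Longrightarrow> (\<And>x. x \<in> S \<Longrightarrow> p x = x) \<Longrightarrow> p permutes (U - S)"
  by (erule permutes_superset) blast

lemma agreement_commute: "(\<exists>k\<in>U. \<sigma> k = \<tau> k) \<longleftrightarrow> (\<exists>k\<in>U. \<tau> k = \<sigma> k)"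
  by (rule bex_cong) auto

lemma card_derangements:
  assumes "finite U"
  shows "card {p. p permutes U \<and> (\<forall>k\<in>U. p k \<noteq> k)} = derange (card U)"
proof -
  obtain f where "bij_betw f U {1..card U}"
    using finite_same_card_bij[OF assms, of "{1..card U}"] by auto
  from bij_betw_same_card[OF bij_betw_derangements[OF this]]
  show ?thesis by (simp add: derange_def)
qed

text \<open>With \<open>l\<close> the preimage of \<open>j\<close> under \<tau>, avoidance is
  automatic at \<open>i\<close> and at \<open>l\<close>, since \<sigma> already takes the value
  \<open>j\<close> at \<open>i\<close>. Undoing \<tau> and moving \<open>l\<close> to
  \<open>i\<close> leaves permutations of \<open>U - {i}\<close> without fixed points except
  possibly \<open>l\<close>; the two summands count those moving \<open>l\<close> and those fixing
  it.\<close>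

lemma card_coset_disjoint:
  assumes U: "finite U" and ij: "i \<in> U" "j \<in> U" and \<tau>: "\<tau> permutes U" "\<tau> i \<noteq> j"
  shows "card (coset_disjoint U i j \<tau>) = derange (card U - 1) + derange (card U - 2)"
proof -
  define l where "l = inv \<tau> j"
  define \<theta> where "\<theta> = transpose i l \<circ> inv \<tau>"
  have \<tau>l: "\<tau> l = j" using permutes_inverses(1)[OF \<tau>(1)] by (simp add: l_def)
  have li: "l \<noteq> i" using \<tau>l \<tau>(2) by auto
  have lU: "l \<in> U" using permutes_in_image[OF permutes_inv[OF \<tau>(1)]] ij by (simp add: l_def)
  have \<theta>: "\<theta> permutes U" unfolding \<theta>_def
    using ij lU by (intro permutes_compose[OF permutes_inv[OF \<tau>(1)]] permutes_swap_id)
  let ?T = "{p. p permutes (U - {i}) \<and> (\<forall>k\<in>U - {i, l}. p k \<noteq> k)}"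
  have "bij_betw (\<lambda>\<sigma>. \<theta> \<circ> \<sigma>) (coset_disjoint U i j \<tau>) ?T"
  proof (rule bij_betw_byWitness[where f' = "\<lambda>p. \<tau> \<circ> transpose i l \<circ> p"])
    show "\<forall>\<sigma>\<in>coset_disjoint U i j \<tau>. \<tau> \<circ> transpose i l \<circ> (\<theta> \<circ> \<sigma>) = \<sigma>"
      using permutes_inverses(1)[OF \<tau>(1)] by (auto simp: \<theta>_def fun_eq_iff)
    show "\<forall>p\<in>?T. \<theta> \<circ> (\<tau> \<circ> transpose i l \<circ> p) = p"
      using permutes_inverses(2)[OF \<tau>(1)] by (auto simp: \<theta>_def fun_eq_iff)
    show "(\<lambda>\<sigma>. \<theta> \<circ> \<sigma>) ` coset_disjoint U i j \<tau> \<subseteq> ?T"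
    proof (rule image_subsetI)
      fix \<sigma> assume "\<sigma> \<in> coset_disjoint U i j \<tau>"
      then have \<sigma>: "\<sigma> permutes U" "\<sigma> i = j" and dis: "\<And>k. k \<in> U \<Longrightarrow> \<sigma> k \<noteq> \<tau> k"
        by (auto simp: coset_disjoint_def)
      have "(\<theta> \<circ> \<sigma>) i = i" using \<sigma> by (simp add: \<theta>_def l_def[symmetric])
      then have "\<theta> \<circ> \<sigma> permutes (U - {i})"
        by (intro permutes_Diff_fixed[OF permutes_compose[OF \<sigma>(1) \<theta>]]) simp
      moreover have "(\<theta> \<circ> \<sigma>) k \<noteq> k" if k: "k \<in> U - {i, l}" for k
      proof
        assume "(\<theta> \<circ> \<sigma>) k = k"
        then have "transpose i l (transpose i l (inv \<tau> (\<sigma> k))) = transpose i l k" by (simp add: \<theta>_def)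
        then have "inv \<tau> (\<sigma> k) = k" using k by (simp add: transpose_apply_other)
        then have "\<sigma> k = \<tau> k" using permutes_inverses(1)[OF \<tau>(1), of "\<sigma> k"] by simp
        then show False using dis k by simp
      qed
      ultimately show "\<theta> \<circ> \<sigma> \<in> ?T" by (intro CollectI conjI ballI)
    qed
    show "(\<lambda>p. \<tau> \<circ> transpose i l \<circ> p) ` ?T \<subseteq> coset_disjoint U i j \<tau>"
    proof (rule image_subsetI)
      fix p assume "p \<in> ?T"
      then have p: "p permutes (U - {i})" and nf: "\<And>k. k \<in> U - {i, l} \<Longrightarrow> p k \<noteq> k" by auto
      have pi: "p i = i" using permutes_not_in[OF p] by simp
      have pU: "p permutes U" using p by (rule permutes_subset) auto
      have "\<tau> \<circ> transpose i l \<circ> p permutes U"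
        using ij lU by (intro permutes_compose[OF pU] permutes_compose[OF _ \<tau>(1)] permutes_swap_id)
      moreover have "(\<tau> \<circ> transpose i l \<circ> p) i = j" by (simp add: pi \<tau>l)
      moreover have "(\<tau> \<circ> transpose i l \<circ> p) k \<noteq> \<tau> k" if k: "k \<in> U" for k
      proof
        assume "(\<tau> \<circ> transpose i l \<circ> p) k = \<tau> k"
        then have t: "transpose i l (p k) = k" using injD[OF permutes_inj[OF \<tau>(1)], of "transpose i l (p k)" k] by simp
        then have t: "p k = transpose i l k" using transpose_involutory[of i l "p k"] by simp
        consider "k = i" | "k = l" | "k \<in> U - {i, l}" using k by blast
        then show False
        proof cases
          case 1 then show False using t pi li by simp
        next
          case 2 then show False using t pi li injD[OF permutes_inj[OF p], of l i] by simp
        next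
          case 3 then show False using t nf[of k] by (simp add: transpose_apply_other)
        qed
      qed
      ultimately show "\<tau> \<circ> transpose i l \<circ> p \<in> coset_disjoint U i j \<tau>"
        unfolding coset_disjoint_def by (intro CollectI conjI ballI)
    qed
  qed
  then have cT: "card (coset_disjoint U i j \<tau>) = card ?T" by (rule bij_betw_same_card)
  let ?D1 = "{p. p permutes (U - {i}) \<and> (\<forall>k\<in>U - {i}. p k \<noteq> k)}"
  let ?D2 = "{p. p permutes (U - {i, l}) \<and> (\<forall>k\<in>U - {i, l}. p k \<noteq> k)}"
  have T: "?T = ?D1 \<union> ?D2"
  proof
    show "?T \<subseteq> ?D1 \<union> ?D2"
    proof
      fix p assume p: "p \<in> ?T"
      show "p \<in> ?D1 \<union> ?D2"
      proof (cases "p l = l")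
        case True
        moreover have "p permutes (U - {i})" using p by simp
        ultimately have "p permutes (U - {i} - {l})" by (intro permutes_Diff_fixed[of p "U - {i}" "{l}"]) simp_all
        moreover have "U - {i} - {l} = U - {i, l}" by auto
        ultimately have "p permutes (U - {i, l})" by simp
        then show ?thesis using p by simp
      next
        case False
        then have "p k \<noteq> k" if "k \<in> U - {i}" for k using p that by (cases "k = l") auto
        then show ?thesis using p by simp
      qed
    qed
    have "p permutes (U - {i})" if "p permutes (U - {i, l})" for p
      using that by (rule permutes_subset) auto
    then have "?D2 \<subseteq> ?T" by (intro subsetI) simp
    then show "?D1 \<union> ?D2 \<subseteq> ?T" by (intro Un_least) auto
  qed
  have "card (?D1 \<union> ?D2) = card ?D1 + card ?D2"
  proof (rule card_Un_disjoint)
    show "finite ?D1" "finite ?D2" using U by (simp_all add: finite_permutes_Collect)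
    show "?D1 \<inter> ?D2 = {}"
    proof (rule equals0I)
      fix p assume p: "p \<in> ?D1 \<inter> ?D2"
      then have "p l = l" by (intro permutes_not_in[of p "U - {i, l}"]) auto
      then show False using p lU li by auto
    qed
  qed
  also have "\<dots> = derange (card (U - {i})) + derange (card (U - {i, l}))"
    using U by (simp add: card_derangements)
  finally have "card (coset_disjoint U i j \<tau>) = derange (card (U - {i})) + derange (card (U - {i, l}))"
    by (simp only: cT T)
  then show ?thesis using U ij lU li by (simp add: card_Diff_subset numeral_2_eq_2)
qed

text \<open>Here \<open>exact_hit\<close> is used with both permutations equal to \<tau>: at least
  \<open>n - 2\<close> points \<open>r\<close> contribute \<open>(n-2)! / 32\<close> each, and
  replacing \<open>(n-2) (n-2)!\<close> by \<open>(n-1)!\<close> costs a factor 2. This yields the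
  density of extremal pairs without asymptotics of derangement numbers.\<close>

lemma coset_meeting_large:
  assumes U: "finite U" and ij: "i \<in> U" "j \<in> U" and \<tau>: "\<tau> permutes U" "\<tau> i \<noteq> j" and n: "23 \<le> card U"
  shows "fact (card U - 1) / 64 \<le> real (card {\<sigma>. \<sigma> permutes U \<and> \<sigma> i = j \<and> (\<exists>k\<in>U. \<sigma> k = \<tau> k)})"
proof -
  let ?R = "{r \<in> U. r \<noteq> i \<and> \<tau> r \<noteq> j}"
  let ?M = "{\<sigma>. \<sigma> permutes U \<and> \<sigma> i = j \<and> (\<exists>k\<in>U. \<sigma> k = \<tau> k)}"
  have "U - {i} - {r \<in> U. \<tau> r = j} \<subseteq> ?R" by auto
  then have "card (U - {i} - {r \<in> U. \<tau> r = j}) \<le> card ?R" using U by (intro card_mono) auto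
  moreover have "card (U - {i}) - card {r \<in> U. \<tau> r = j} \<le> card (U - {i} - {r \<in> U. \<tau> r = j})"
    using U by (intro diff_card_le_card_Diff) auto
  ultimately have R: "card U - 2 \<le> card ?R"
    using card_le_one_of_inj[OF permutes_inj_on[OF \<tau>(1)], of U j] U ij by simp
  define m where "m = card U - 2"
  have m: "card U = Suc (Suc m)" "21 \<le> m" using n by (auto simp: m_def)
  have "real (card U - 2) * fact (card U - 2) \<le> real (card ?R) * fact (card U - 2)"
    using R by (intro mult_right_mono) auto
  also have "\<dots> \<le> 32 * real (card (\<Union>r\<in>?R. exact_hit U i j \<tau> \<tau> r))"
    using assms by (intro card_UN_exact_hit) auto
  also have "card (\<Union>r\<in>?R. exact_hit U i j \<tau> \<tau> r) \<le> card ?M"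
    by (intro card_mono) (auto simp: exact_hit_def finite_permutes_Collect[OF U])
  finally have "real m * fact m \<le> 32 * real (card ?M)" by (simp add: m)
  moreover have "(fact (card U - 1) :: real) = (real m + 1) * fact m" by (simp add: m)
  moreover have "(real m + 1) * fact m \<le> 2 * (real m * fact m)"
    using m by (simp add: distrib_right)
  ultimately show ?thesis by linarith
qed

text \<open>Two regimes. If \<open>X\<close> has at most \<open>(n-2)! / 32\<close> elements, one
  useful disagreement between two of them excludes enough. Otherwise \<open>X\<close> is too large
  to consist only of permutations agreeing with \<open>x\<close> on half of the points, and the many
  disagreements with some other \<open>y\<close> exclude at least \<open>(n-1)! / 128\<close> more,
  which is where \<open>small\<close> comes from.\<close>

lemma card_UN_coset_disjoint:
  assumes U: "finite U" and ij: "i \<in> U" "j \<in> U" and n: "1000 \<le> card U"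
    and X: "X \<subseteq> {\<sigma>. \<sigma> permutes U \<and> \<sigma> i \<noteq> j}" "2 \<le> card X"
    and small: "real (card X) \<le> fact (card U - 1) / 128"
  shows "derange (card U - 1) + derange (card U - 2) + card X \<le> card (\<Union>x\<in>X. coset_disjoint U i j x)"
proof -
  let ?D = "coset_disjoint U i j"
  let ?d = "derange (card U - 1) + derange (card U - 2)"
  have "X \<subseteq> {\<sigma>. \<sigma> permutes U}" using X(1) by auto
  then have fX: "finite X" by (rule finite_perm_family[OF U])
  have two: "?d + card (?D y - ?D x) \<le> card (\<Union>x\<in>X. ?D x)" if x: "x \<in> X" and y: "y \<in> X" for x y
  proof -
    have "card (?D x) = ?d" using X x U ij by (intro card_coset_disjoint) auto
    moreover have "card (?D x \<union> (?D y - ?D x)) = card (?D x) + card (?D y - ?D x)"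
      using finite_coset_disjoint[OF U] by (intro card_Un_disjoint) auto
    moreover have "card (?D x \<union> (?D y - ?D x)) \<le> card (\<Union>x\<in>X. ?D x)"
      using x y fX finite_coset_disjoint[OF U] by (intro card_mono) auto
    ultimately show ?thesis by simp
  qed
  have diff: "real (card {r \<in> U. r \<noteq> i \<and> x r \<noteq> j \<and> x r \<noteq> y r}) * fact (card U - 2)
     \<le> 32 * real (card (?D y - ?D x))" if "x \<in> X" "y \<in> X" for x y
    using X that n by (intro card_coset_disjoint_Diff U ij) auto
  show ?thesis
  proof (cases "32 * real (card X) \<le> fact (card U - 2)")
    case True
    have "\<not> card X \<le> Suc 0" using X(2) by simp
    then obtain x y where xy: "x \<in> X" "y \<in> X" "x \<noteq> y"
      using card_le_Suc0_iff_eq[OF fX] by blast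
    let ?R = "{r \<in> U. r \<noteq> i \<and> x r \<noteq> j \<and> x r \<noteq> y r}"
    have "?R \<noteq> {}" using X xy by (intro card_disagreement(2)[OF U ij(1)]) auto
    then have "1 \<le> card ?R" using U by (simp add: Suc_le_eq card_gt_0_iff)
    then have "1 * fact (card U - 2) \<le> real (card ?R) * fact (card U - 2)" by (intro mult_right_mono) auto
    also note diff[OF xy(1,2)]
    finally have "card X \<le> card (?D y - ?D x)" using True by simp
    then show ?thesis using two[OF xy(1,2)] by simp
  next
    case False
    obtain x where x: "x \<in> X" using X(2) by (cases "X = {}") auto
    let ?S = "{y. y permutes U \<and> real (card U) / 2 \<le> real (agr U x y)}"
    have "32 * real (card ?S) < fact (card U - 2)"
      by (rule card_agr_large[OF U _ n]) (use X x in auto)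
    then have "card ?S < card X" using False by linarith
    moreover have "finite ?S" by (rule finite_permutes_Collect[OF U])
    ultimately have "\<not> X \<subseteq> ?S" using card_mono[of ?S X] by linarith
    then obtain y where "y \<in> X" "y \<notin> ?S" by blast
    then have y: "y \<in> X" "real (agr U x y) < real (card U) / 2"
      using X by (auto simp: not_le)
    let ?R = "{r \<in> U. r \<noteq> i \<and> x r \<noteq> j \<and> x r \<noteq> y r}"
    have "card U \<le> agr U x y + card ?R + 2"
      using X x y by (intro card_disagreement(1)[OF U ij(1)]) auto
    \<comment> \<open>Here \<open>n / 2 - 2 \<ge> (n - 1) / 4\<close>; this factor 4 times the 32 of
      a single disagreement is 128.\<close>
    then have "real (card U - 1) \<le> 4 * real (card ?R)" using y n by linarith
    then have "real (card U - 1) * fact (card U - 2) \<le> 4 * real (card ?R) * fact (card U - 2)"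
      by (intro mult_right_mono) auto
    also have "\<dots> \<le> 128 * real (card (?D y - ?D x))" using diff[OF x y(1)] by linarith
    also have "real (card U - 1) * fact (card U - 2) = fact (card U - 1)"
    proof -
      define m where "m = card U - 2"
      have "card U = Suc (Suc m)" using n by (simp add: m_def)
      then show ?thesis by simp
    qed
    finally have "card X \<le> card (?D y - ?D x)" using small by simp
    then show ?thesis using two[OF x y(1)] by simp
  qed
qed

section \<open>Stability: concentration on a common 1-coset\<close>

text \<open>Only an inequality, as the two prescribed values may be incompatible.\<close>

lemma card_permutes_two_fixed:
  assumes U: "finite U" and ik: "i \<in> U" "k \<in> U" "i \<noteq> k"
  shows "card {\<sigma>. \<sigma> permutes U \<and> \<sigma> i = j \<and> \<sigma> k = l} \<le> fact (card U - 2)"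
proof (cases "{\<sigma>. \<sigma> permutes U \<and> \<sigma> i = j \<and> \<sigma> k = l} = {}")
  case False
  then obtain \<theta> where \<theta>: "\<theta> permutes U" "\<theta> i = j" "\<theta> k = l" by auto
  have "card {\<sigma>. \<sigma> permutes U \<and> \<sigma> i = j \<and> \<sigma> k = l} \<le> card {\<sigma>. \<sigma> permutes (U - {i, k})}"
  proof (rule card_inj_on_le)
    show "inj_on (\<lambda>\<sigma>. inv \<theta> \<circ> \<sigma>) {\<sigma>. \<sigma> permutes U \<and> \<sigma> i = j \<and> \<sigma> k = l}"
    proof (rule inj_onI)
      fix \<sigma> \<tau> assume eq: "inv \<theta> \<circ> \<sigma> = inv \<theta> \<circ> \<tau>"
      show "\<sigma> = \<tau>"
      proof
        fix k
        from fun_cong[OF eq, of k] have "inv \<theta> (\<sigma> k) = inv \<theta> (\<tau> k)" by simp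
        then show "\<sigma> k = \<tau> k" by (rule injD[OF permutes_inj[OF permutes_inv[OF \<theta>(1)]]])
      qed
    qed
    show "(\<lambda>\<sigma>. inv \<theta> \<circ> \<sigma>) ` {\<sigma>. \<sigma> permutes U \<and> \<sigma> i = j \<and> \<sigma> k = l} \<subseteq> {\<sigma>. \<sigma> permutes (U - {i, k})}"
    proof clarify
      fix \<sigma> assume \<sigma>: "\<sigma> permutes U" "j = \<sigma> i" "l = \<sigma> k"
      have "inv \<theta> (\<sigma> i) = i" "inv \<theta> (\<sigma> k) = k"
        using \<theta> \<sigma> permutes_inverses(2)[OF \<theta>(1), of i] permutes_inverses(2)[OF \<theta>(1), of k] by simp_all
      then show "inv \<theta> \<circ> \<sigma> permutes U - {i, k}"
        by (intro permutes_Diff_fixed[OF permutes_compose[OF \<sigma>(1) permutes_inv[OF \<theta>(1)]]]) auto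
    qed
  qed (use U in \<open>simp add: finite_permutations\<close>)
  also have "\<dots> = fact (card U - 2)"
    using U ik by (subst card_permutations[OF refl]) (auto simp: card_Diff_subset numeral_2_eq_2)
  finally show ?thesis .
next
  case True
  show ?thesis unfolding True by simp
qed

text \<open>The common heavy cell \<open>(k, l)\<close> is not in row \<open>i\<close>, where
  \<open>B\<close> allows only \<open>j\<close> and \<open>A\<close> forbids it. Otherwise a fixed
  multiple of \<open>(n-1)!\<close> members of \<open>B\<close> would have two prescribed values,
  but at most \<open>(n-2)!\<close> permutations do.\<close>

lemma stability_one_sided:
  assumes c: "0 < c"
  shows "\<exists>n0. \<forall>(U :: 'a set) A B i j. dense_family U c A \<longrightarrow> dense_family U c B \<longrightarrow> n0 \<le> real (card U) \<longrightarrow>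
    (\<forall>\<sigma>\<in>A. \<forall>\<tau>\<in>B. \<exists>k\<in>U. \<sigma> k = \<tau> k) \<longrightarrow> i \<in> U \<longrightarrow> (\<forall>\<sigma>\<in>A. \<sigma> i \<noteq> j) \<longrightarrow> \<not> (\<forall>\<tau>\<in>B. \<tau> i = j)"
proof -
  from cross_intersecting_common_heavy[OF c, where 'a = 'a] obtain \<epsilon> n1 where \<epsilon>: "0 < \<epsilon>" and
    n1: "\<And>(U :: 'a set) A B. dense_family U c A \<Longrightarrow> dense_family U c B \<Longrightarrow> n1 \<le> real (card U) \<Longrightarrow>
    (\<forall>\<sigma>\<in>A. \<forall>\<tau>\<in>B. \<exists>k\<in>U. \<sigma> k = \<tau> k) \<Longrightarrow>
    (\<exists>i\<in>U. \<exists>j\<in>U. \<epsilon> \<le> freq A i j \<and> \<epsilon> \<le> freq B i j)"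
    by blast
  have "\<not> (\<forall>\<tau>\<in>B. \<tau> i = j)"
    if A: "dense_family U c A" and B: "dense_family U c B" and n: "max (max n1 2) (1 / (\<epsilon> * c) + 2) \<le> real (card U)"
      and cross: "\<forall>\<sigma>\<in>A. \<forall>\<tau>\<in>B. \<exists>k\<in>U. \<sigma> k = \<tau> k" and i: "i \<in> U" and Aij: "\<forall>\<sigma>\<in>A. \<sigma> i \<noteq> j"
    for U :: "'a set" and A B i j
  proof
    assume Bij: "\<forall>\<tau>\<in>B. \<tau> i = j"
    interpret B: dense_family U c B by fact
    obtain k l where kl: "k \<in> U" "l \<in> U" and fA: "\<epsilon> \<le> freq A k l" and fB: "\<epsilon> \<le> freq B k l"
      using n1[OF A B _ cross] n by auto
    have neA: "{\<sigma> \<in> A. \<sigma> k = l} \<noteq> {}"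
    proof
      assume "{\<sigma> \<in> A. \<sigma> k = l} = {}"
      then have "freq A k l = 0" by (simp only: freq_def card.empty of_nat_0 div_0)
      then show False using fA \<epsilon> by simp
    qed
    have ik: "i \<noteq> k"
    proof
      assume "i = k"
      have "{\<sigma> \<in> B. \<sigma> k = l} \<noteq> {}"
      proof
        assume "{\<sigma> \<in> B. \<sigma> k = l} = {}"
        then have "freq B k l = 0" by (simp only: freq_def card.empty of_nat_0 div_0)
        then show False using fB \<epsilon> by simp
      qed
      then have "l = j" using Bij \<open>i = k\<close> by auto
      then show False using neA Aij \<open>i = k\<close> by auto
    qed
    define m where "m = card U - 2"
    have "2 \<le> card U" using n by simp
    then have m: "card U = Suc (Suc m)" by (simp add: m_def)
    have "\<epsilon> * (c * fact (card U - 1)) \<le> freq B k l * real (card B)"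
      using \<epsilon> c fB B.dense by (intro mult_mono) auto
    also have "\<dots> = real (card {\<sigma> \<in> B. \<sigma> k = l})" using card_eq_freq[OF B.finite_A] by simp
    also have "card {\<sigma> \<in> B. \<sigma> k = l} \<le> card {\<sigma>. \<sigma> permutes U \<and> \<sigma> i = j \<and> \<sigma> k = l}"
      using B.family Bij by (intro card_mono) (auto simp: finite_permutes_Collect[OF B.finite_U])
    also have "\<dots> \<le> fact (card U - 2)" by (rule card_permutes_two_fixed[OF B.finite_U i kl(1) ik])
    finally have "\<epsilon> * (c * fact (Suc m)) \<le> fact m" by (simp add: m)
    moreover have "\<epsilon> * (c * fact (Suc m)) = (\<epsilon> * c * (real m + 1)) * fact m" by (simp add: algebra_simps)
    ultimately have "(\<epsilon> * c * (real m + 1)) * fact m \<le> 1 * fact m" by linarith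
    then have "\<epsilon> * c * (real m + 1) \<le> 1" by (subst (asm) mult_le_cancel_right_pos) auto
    then have "real m + 1 \<le> 1 / (\<epsilon> * c)" using \<epsilon> c by (simp add: field_simps)
    moreover have "1 / (\<epsilon> * c) + 2 \<le> real m + 2" using n m by simp
    ultimately show False by linarith
  qed
  note main = this
  show ?thesis by (intro exI allI impI) (rule main)
qed

lemma stability:
  "\<exists>n0. \<forall>(U :: 'a set) A B. dense_family U (1 / 64) A \<longrightarrow> dense_family U (1 / 64) B \<longrightarrow> n0 \<le> real (card U) \<longrightarrow>
    (\<forall>\<sigma>\<in>A. \<forall>\<tau>\<in>B. \<exists>k\<in>U. \<sigma> k = \<tau> k) \<longrightarrow>
    (\<exists>i\<in>U. \<exists>j\<in>U. real (card {\<sigma> \<in> A. \<sigma> i \<noteq> j}) \<le> fact (card U - 1) / 128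
       \<and> real (card {\<sigma> \<in> B. \<sigma> i \<noteq> j}) \<le> fact (card U - 1) / 128)"
proof -
  have c: "0 < (1 / 64 :: real)" by simp
  from cross_intersecting_common_heavy[OF c, where 'a = 'a] obtain \<epsilon> n1 where \<epsilon>: "0 < \<epsilon>" and
    n1: "\<And>(U :: 'a set) A B. dense_family U (1 / 64) A \<Longrightarrow> dense_family U (1 / 64) B \<Longrightarrow> n1 \<le> real (card U) \<Longrightarrow>
    (\<forall>\<sigma>\<in>A. \<forall>\<tau>\<in>B. \<exists>k\<in>U. \<sigma> k = \<tau> k) \<Longrightarrow>
    (\<exists>i\<in>U. \<exists>j\<in>U. \<epsilon> \<le> freq A i j \<and> \<epsilon> \<le> freq B i j)"
    by blast
  \<comment> \<open>A density valid for both test families: the outside part of \<open>A\<close>,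
    assumed larger than \<open>(n-1)! / 128\<close>, and the inside part of \<open>B\<close>, an
    \<open>\<epsilon>\<close> share of at least \<open>(n-1)! / 64\<close>.\<close>
  define c' where "c' = min (1 / 128) (\<epsilon> / 64)"
  have c': "0 < c'" using \<epsilon> by (simp add: c'_def)
  from stability_one_sided[OF c', where 'a = 'a] obtain n2 where
    n2: "\<And>(U :: 'a set) A B i j. dense_family U c' A \<Longrightarrow> dense_family U c' B \<Longrightarrow> n2 \<le> real (card U) \<Longrightarrow>
    (\<forall>\<sigma>\<in>A. \<forall>\<tau>\<in>B. \<exists>k\<in>U. \<sigma> k = \<tau> k) \<Longrightarrow> i \<in> U \<Longrightarrow> (\<forall>\<sigma>\<in>A. \<sigma> i \<noteq> j) \<Longrightarrow> \<not> (\<forall>\<tau>\<in>B. \<tau> i = j)"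
    by blast
  have half: "real (card {\<sigma> \<in> A. \<sigma> i \<noteq> j}) \<le> fact (card U - 1) / 128"
    if A: "dense_family U (1 / 64) A" and B: "dense_family U (1 / 64) B" and n: "n2 \<le> real (card U)"
      and cross: "\<forall>\<sigma>\<in>A. \<forall>\<tau>\<in>B. \<exists>k\<in>U. \<sigma> k = \<tau> k" and i: "i \<in> U" and f: "\<epsilon> \<le> freq B i j"
    for U :: "'a set" and A B i j
  proof (rule ccontr)
    assume large: "\<not> real (card {\<sigma> \<in> A. \<sigma> i \<noteq> j}) \<le> fact (card U - 1) / 128"
    interpret A: dense_family U "1 / 64" A by fact
    interpret B: dense_family U "1 / 64" B by fact
    have fac: "c' * fact (card U - 1) \<le> x * fact (card U - 1)" if "c' \<le> x" for x
      using that by (intro mult_right_mono) auto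
    have dA: "dense_family U c' {\<sigma> \<in> A. \<sigma> i \<noteq> j}"
    proof
      have "c' * fact (card U - 1) \<le> 1 / 128 * fact (card U - 1)" by (rule fac) (simp add: c'_def)
      then show "c' * fact (card U - 1) \<le> real (card {\<sigma> \<in> A. \<sigma> i \<noteq> j})" using large by linarith
    qed (use A.finite_U A.U_nonempty c' A.family in auto)
    have dB: "dense_family U c' {\<sigma> \<in> B. \<sigma> i = j}"
    proof
      have "c' * fact (card U - 1) \<le> \<epsilon> / 64 * fact (card U - 1)" by (rule fac) (simp add: c'_def)
      also have "\<dots> = \<epsilon> * (1 / 64 * fact (card U - 1))" by simp
      also have "\<dots> \<le> freq B i j * real (card B)"
        using f \<epsilon> B.dense by (intro mult_mono) auto
      finally show "c' * fact (card U - 1) \<le> real (card {\<sigma> \<in> B. \<sigma> i = j})"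
        by (simp add: card_eq_freq[OF B.finite_A])
    qed (use B.finite_U B.U_nonempty c' B.family in auto)
    have "\<not> (\<forall>\<tau>\<in>{\<sigma> \<in> B. \<sigma> i = j}. \<tau> i = j)"
      by (rule n2[OF dA dB n _ i]) (use cross in auto)
    then show False by simp
  qed
  have "\<exists>i\<in>U. \<exists>j\<in>U. real (card {\<sigma> \<in> A. \<sigma> i \<noteq> j}) \<le> fact (card U - 1) / 128
       \<and> real (card {\<sigma> \<in> B. \<sigma> i \<noteq> j}) \<le> fact (card U - 1) / 128"
    if A: "dense_family U (1 / 64) A" and B: "dense_family U (1 / 64) B" and n: "max n1 n2 \<le> real (card U)"
      and cross: "\<forall>\<sigma>\<in>A. \<forall>\<tau>\<in>B. \<exists>k\<in>U. \<sigma> k = \<tau> k"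
    for U :: "'a set" and A B
  proof -
    obtain i j where ij: "i \<in> U" "j \<in> U" and f: "\<epsilon> \<le> freq A i j" "\<epsilon> \<le> freq B i j"
      using n1[OF A B _ cross] n by auto
    have cross': "\<forall>\<tau>\<in>B. \<forall>\<sigma>\<in>A. \<exists>k\<in>U. \<tau> k = \<sigma> k" using cross by (subst agreement_commute) blast
    show ?thesis
      using half[OF A B _ cross ij(1) f(2)] half[OF B A _ cross' ij(1) f(1)] n ij by auto
  qed
  note main = this
  show ?thesis by (intro exI allI impI) (rule main)
qed

section \<open>Structure of pairs attaining the bound\<close>

lemma card_coset_meeting:
  assumes U: "finite U" and ij: "i \<in> U" "j \<in> U" and \<tau>: "\<tau> permutes U" "\<tau> i \<noteq> j"
  shows "card {\<sigma>. \<sigma> permutes U \<and> \<sigma> i = j \<and> (\<exists>k\<in>U. \<sigma> k = \<tau> k)}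
     + (derange (card U - 1) + derange (card U - 2)) = fact (card U - 1)"
proof -
  let ?M = "{\<sigma>. \<sigma> permutes U \<and> \<sigma> i = j \<and> (\<exists>k\<in>U. \<sigma> k = \<tau> k)}"
  have "card (?M \<union> coset_disjoint U i j \<tau>) = card ?M + card (coset_disjoint U i j \<tau>)"
    by (intro card_Un_disjoint finite_coset_disjoint finite_permutes_Collect U) (auto simp: coset_disjoint_def)
  moreover have "?M \<union> coset_disjoint U i j \<tau> = {\<sigma>. \<sigma> permutes U \<and> \<sigma> i = j}"
    by (auto simp: coset_disjoint_def)
  ultimately show ?thesis
    by (simp add: card_permutes_fixed[OF U ij] card_coset_disjoint[OF U ij \<tau>])
qed

text \<open>Both sizes are only assumed to reach the bound, not to equal it, so the lemma serves the
  upper bound as well as the equality case. The derangement numbers stand on the larger side to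
  avoid truncated subtraction.\<close>

lemma extremal_structure:
  assumes U: "finite U" and n: "1000 \<le> card U" and ij: "i \<in> U" "j \<in> U"
    and A: "A \<subseteq> {\<sigma>. \<sigma> permutes U}" and B: "B \<subseteq> {\<sigma>. \<sigma> permutes U}"
    and cross: "\<forall>\<sigma>\<in>A. \<forall>\<tau>\<in>B. \<exists>k\<in>U. \<sigma> k = \<tau> k"
    and out: "\<not> (A \<subseteq> {\<sigma>. \<sigma> i = j} \<and> B \<subseteq> {\<sigma>. \<sigma> i = j})"
    and a: "fact (card U - 1) + 1 \<le> card A + (derange (card U - 1) + derange (card U - 2))"
    and b: "fact (card U - 1) + 1 \<le> card B + (derange (card U - 1) + derange (card U - 2))"
    and sa: "real (card {\<sigma> \<in> A. \<sigma> i \<noteq> j}) \<le> fact (card U - 1) / 128"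
    and sb: "real (card {\<sigma> \<in> B. \<sigma> i \<noteq> j}) \<le> fact (card U - 1) / 128"
  obtains \<tau> \<rho> where "\<tau> permutes U" "\<rho> permutes U" "\<exists>k\<in>U. \<tau> k = \<rho> k" "\<tau> i \<noteq> j" "\<rho> i \<noteq> j"
    "A = {\<sigma>. \<sigma> permutes U \<and> \<sigma> i = j \<and> (\<exists>k\<in>U. \<sigma> k = \<tau> k)} \<union> {\<rho>}"
    "B = {\<sigma>. \<sigma> permutes U \<and> \<sigma> i = j \<and> (\<exists>k\<in>U. \<sigma> k = \<rho> k)} \<union> {\<tau>}"
proof -
  let ?d = "derange (card U - 1) + derange (card U - 2)"
  let ?M = "\<lambda>\<tau>. {\<sigma>. \<sigma> permutes U \<and> \<sigma> i = j \<and> (\<exists>k\<in>U. \<sigma> k = \<tau> k)}"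
  let ?out = "\<lambda>A. {\<sigma> \<in> A. \<sigma> i \<noteq> j}"
  let ?inn = "\<lambda>A. {\<sigma> \<in> A. \<sigma> i = j}"
  have cross': "\<forall>\<tau>\<in>B. \<forall>\<sigma>\<in>A. \<exists>k\<in>U. \<tau> k = \<sigma> k" using cross by (subst agreement_commute) blast
  have split: "card A = card (?inn A) + card (?out A)" if "A \<subseteq> {\<sigma>. \<sigma> permutes U}" for A
  proof -
    have "finite A" using finite_perm_family[OF U that] .
    then have "card (?inn A \<union> ?out A) = card (?inn A) + card (?out A)" by (intro card_Un_disjoint) auto
    moreover have "?inn A \<union> ?out A = A" by auto
    ultimately show ?thesis by simp
  qed
  \<comment> \<open>The inside of \<open>A\<close> and all that the outside of \<open>B\<close>
    excludes share the \<open>(n-1)!\<close> places of the 1-coset. Since \<open>A\<close> is large,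
    any exclusion beyond that of one permutation has to be made up by members of \<open>A\<close>
    outside.\<close>
  have union: "card (\<Union>\<tau>\<in>?out B. coset_disjoint U i j \<tau>) + 1 \<le> ?d + card (?out A)"
    if A: "A \<subseteq> {\<sigma>. \<sigma> permutes U}" and B: "B \<subseteq> {\<sigma>. \<sigma> permutes U}"
      and cross: "\<forall>\<sigma>\<in>A. \<forall>\<tau>\<in>B. \<exists>k\<in>U. \<sigma> k = \<tau> k" and a: "fact (card U - 1) + 1 \<le> card A + ?d" for A B
  proof -
    let ?D = "\<Union>\<tau>\<in>?out B. coset_disjoint U i j \<tau>"
    have fin: "finite A" "finite B" using finite_perm_family[OF U] A B by auto
    have "card (?inn A \<union> ?D) = card (?inn A) + card ?D"
    proof (rule card_Un_disjoint)
      show "finite (?inn A)" "finite ?D" using fin finite_coset_disjoint[OF U] by auto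
      show "?inn A \<inter> ?D = {}" using cross by (auto simp: coset_disjoint_def)
    qed
    moreover have "card (?inn A \<union> ?D) \<le> card {\<sigma>. \<sigma> permutes U \<and> \<sigma> i = j}"
      using A by (intro card_mono) (auto simp: coset_disjoint_def finite_permutes_Collect[OF U])
    ultimately have "card (?inn A) + card ?D \<le> fact (card U - 1)"
      by (simp add: card_permutes_fixed[OF U ij])
    then show ?thesis using split[OF A] a by linarith
  qed
  \<comment> \<open>If \<open>B\<close> lay inside, \<open>A\<close> would have an outside member
    \<open>\<rho>\<close>, and \<open>B\<close> would be confined to the permutations meeting
    \<open>\<rho>\<close>: one fewer than required.\<close>
  have nonempty: "?out B \<noteq> {}"
    if A: "A \<subseteq> {\<sigma>. \<sigma> permutes U}" and B: "B \<subseteq> {\<sigma>. \<sigma> permutes U}"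
      and cross: "\<forall>\<sigma>\<in>A. \<forall>\<tau>\<in>B. \<exists>k\<in>U. \<sigma> k = \<tau> k"
      and out: "\<not> (A \<subseteq> {\<sigma>. \<sigma> i = j} \<and> B \<subseteq> {\<sigma>. \<sigma> i = j})"
      and b: "fact (card U - 1) + 1 \<le> card B + ?d" for A B
  proof
    assume empty: "?out B = {}"
    then have "B \<subseteq> {\<sigma>. \<sigma> i = j}" by auto
    with out obtain \<rho> where \<rho>: "\<rho> \<in> A" "\<rho> i \<noteq> j" by auto
    have "B \<subseteq> ?M \<rho>"
    proof
      fix \<tau> assume \<tau>: "\<tau> \<in> B"
      obtain k where "k \<in> U" "\<rho> k = \<tau> k" using cross \<rho>(1) \<tau> by blast
      then have "\<exists>k\<in>U. \<tau> k = \<rho> k" by (intro bexI[of _ k]) simp_all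
      then show "\<tau> \<in> ?M \<rho>" using \<tau> B \<open>B \<subseteq> {\<sigma>. \<sigma> i = j}\<close> by auto
    qed
    then have "card B \<le> card (?M \<rho>)" by (intro card_mono finite_permutes_Collect U)
    moreover have "card (?M \<rho>) + ?d = fact (card U - 1)"
      using A \<rho> by (intro card_coset_meeting U ij) auto
    ultimately show False using b by linarith
  qed
  have out': "\<not> (B \<subseteq> {\<sigma>. \<sigma> i = j} \<and> A \<subseteq> {\<sigma>. \<sigma> i = j})" using out by blast
  have fo: "finite (?out A)" "finite (?out B)" using finite_perm_family[OF U] A B by auto
  have oneA: "1 \<le> card (?out A)" and oneB: "1 \<le> card (?out B)"
    using nonempty[OF A B cross out b] nonempty[OF B A cross' out' a] fo
    by (simp_all only: Suc_le_eq card_gt_0_iff One_nat_def simp_thms)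
  \<comment> \<open>Two or more outside members on one side force strictly more on the other. By
    symmetry this is impossible.\<close>
  have less: "card (?out B) < card (?out A)" if "2 \<le> card (?out B)"
  proof -
    have "?d + card (?out B) \<le> card (\<Union>\<tau>\<in>?out B. coset_disjoint U i j \<tau>)"
      using B that sb by (intro card_UN_coset_disjoint U ij n) auto
    then show ?thesis using union[OF A B cross a] by linarith
  qed
  have less': "card (?out A) < card (?out B)" if "2 \<le> card (?out A)"
  proof -
    have "?d + card (?out A) \<le> card (\<Union>\<tau>\<in>?out A. coset_disjoint U i j \<tau>)"
      using A that sa by (intro card_UN_coset_disjoint U ij n) auto
    then show ?thesis using union[OF B A cross' b] by linarith
  qed
  have cA: "card (?out A) = 1" and cB: "card (?out B) = 1" using less less' oneA oneB by linarith+
  obtain \<rho> where \<rho>: "?out A = {\<rho>}" using cA by (rule card_1_singletonE)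
  obtain \<tau> where \<tau>: "?out B = {\<tau>}" using cB by (rule card_1_singletonE)
  have \<rho>A: "\<rho> \<in> A" "\<rho> i \<noteq> j" and \<tau>B: "\<tau> \<in> B" "\<tau> i \<noteq> j" using \<rho> \<tau> by blast+
  \<comment> \<open>With a single outside member on each side the size bound for the inside part
    equals the size of the set containing it.\<close>
  have eq: "A = ?M \<tau> \<union> {\<rho>}"
    if A: "A \<subseteq> {\<sigma>. \<sigma> permutes U}" and cross: "\<forall>\<sigma>\<in>A. \<exists>k\<in>U. \<sigma> k = \<tau> k" and \<rho>: "?out A = {\<rho>}"
      and a: "fact (card U - 1) + 1 \<le> card A + ?d" and \<tau>: "\<tau> permutes U" "\<tau> i \<noteq> j" for A \<rho> \<tau>
  proof -
    have fM: "finite (?M \<tau>)" by (rule finite_permutes_Collect[OF U])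
    have sub: "?inn A \<subseteq> ?M \<tau>" using A cross by auto
    have "card (?M \<tau>) + ?d = fact (card U - 1)" by (rule card_coset_meeting[OF U ij \<tau>])
    then have "card (?M \<tau>) \<le> card (?inn A)" using split[OF A] \<rho> a by simp
    then have "?inn A = ?M \<tau>" by (rule card_seteq[OF fM sub])
    moreover have "A = ?inn A \<union> ?out A" by auto
    ultimately show ?thesis using \<rho> by simp
  qed
  show thesis
  proof (rule that)
    show "\<tau> permutes U" "\<rho> permutes U" using A B \<rho>A \<tau>B by auto
    show "\<exists>k\<in>U. \<tau> k = \<rho> k" using cross' \<rho>A \<tau>B by blast
    show "\<tau> i \<noteq> j" "\<rho> i \<noteq> j" by fact+
    show "A = ?M \<tau> \<union> {\<rho>}" using A B cross \<rho> a \<tau>B by (intro eq) auto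
    show "B = ?M \<rho> \<union> {\<tau>}" using A B cross' \<tau> b \<rho>A by (intro eq) auto
  qed
qed

section \<open>Bound and equality case for permutations of \<open>{1..n}\<close>\<close>

theorem theorem9:
  shows "\<exists>n0::nat. \<forall>n\<ge>n0. \<forall>A B.
     A \<subseteq> Sym n \<and> B \<subseteq> Sym n \<and> cross_intersecting n A B \<and>
     \<not> (\<exists>i\<in>{1..n}. \<exists>j\<in>{1..n}. A \<subseteq> one_coset n i j \<and> B \<subseteq> one_coset n i j)
     \<longrightarrow>
     int (min (card A) (card B)) \<le> int (fact (n - 1)) - int (derange (n - 1)) - int (derange (n - 2)) + 1 \<and>
     (int (min (card A) (card B)) = int (fact (n - 1)) - int (derange (n - 1)) - int (derange (n - 2)) + 1
      \<longleftrightarrow>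
      (\<exists>i\<in>{1..n}. \<exists>j\<in>{1..n}. \<exists>\<tau>\<in>Sym n. \<exists>\<rho>\<in>Sym n.
         perm_intersect n \<tau> \<rho> \<and> \<tau> i \<noteq> j \<and> \<rho> i \<noteq> j \<and>
         A = {\<sigma> \<in> one_coset n i j. perm_intersect n \<sigma> \<tau>} \<union> {\<rho>} \<and>
         B = {\<sigma> \<in> one_coset n i j. perm_intersect n \<sigma> \<rho>} \<union> {\<tau>}))"
proof -
  from stability[where 'a = nat] obtain n1 where
    n1: "\<And>(U :: nat set) A B. dense_family U (1 / 64) A \<Longrightarrow> dense_family U (1 / 64) B \<Longrightarrow> n1 \<le> real (card U) \<Longrightarrow>
    (\<forall>\<sigma>\<in>A. \<forall>\<tau>\<in>B. \<exists>k\<in>U. \<sigma> k = \<tau> k) \<Longrightarrow>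
    (\<exists>i\<in>U. \<exists>j\<in>U. real (card {\<sigma> \<in> A. \<sigma> i \<noteq> j}) \<le> fact (card U - 1) / 128
       \<and> real (card {\<sigma> \<in> B. \<sigma> i \<noteq> j}) \<le> fact (card U - 1) / 128)"
    by blast
  show ?thesis
  proof (intro exI allI impI)
    fix n A B
    assume n: "max 1000 (nat \<lceil>n1\<rceil>) \<le> n"
      and "A \<subseteq> Sym n \<and> B \<subseteq> Sym n \<and> cross_intersecting n A B \<and>
       \<not> (\<exists>i\<in>{1..n}. \<exists>j\<in>{1..n}. A \<subseteq> one_coset n i j \<and> B \<subseteq> one_coset n i j)"
    then have A: "A \<subseteq> Sym n" and B: "B \<subseteq> Sym n" and ci: "cross_intersecting n A B"
      and out: "\<And>i j. i \<in> {1..n} \<Longrightarrow> j \<in> {1..n} \<Longrightarrow> \<not> (A \<subseteq> one_coset n i j \<and> B \<subseteq> one_coset n i j)"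
      by auto
    let ?U = "{1..n}"
    let ?d = "derange (n - 1) + derange (n - 2)"
    let ?ext = "\<lambda>i j \<tau> \<rho>. perm_intersect n \<tau> \<rho> \<and> \<tau> i \<noteq> j \<and> \<rho> i \<noteq> j \<and>
         A = {\<sigma> \<in> one_coset n i j. perm_intersect n \<sigma> \<tau>} \<union> {\<rho>} \<and>
         B = {\<sigma> \<in> one_coset n i j. perm_intersect n \<sigma> \<rho>} \<union> {\<tau>}"
    have meet: "{\<sigma> \<in> one_coset n i j. perm_intersect n \<sigma> \<tau>}
        = {\<sigma>. \<sigma> permutes ?U \<and> \<sigma> i = j \<and> (\<exists>k\<in>?U. \<sigma> k = \<tau> k)}" for i j \<tau>
      by (auto simp: one_coset_def Sym_def perm_intersect_def)
    have card_meet: "card ({\<sigma> \<in> one_coset n i j. perm_intersect n \<sigma> \<tau>} \<union> {\<rho>}) + ?d = fact (n - 1) + 1"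
      if "i \<in> ?U" "j \<in> ?U" "\<tau> \<in> Sym n" "\<tau> i \<noteq> j" "\<rho> i \<noteq> j" for i j \<tau> \<rho>
    proof -
      have "finite {\<sigma>. \<sigma> permutes ?U \<and> \<sigma> i = j \<and> (\<exists>k\<in>?U. \<sigma> k = \<tau> k)}"
        by (rule finite_permutes_Collect) simp
      then show ?thesis
        using that card_coset_meeting[of ?U i j \<tau>] unfolding meet by (simp add: Sym_def)
    qed
    have equality: "card A + ?d = fact (n - 1) + 1 \<and> card B + ?d = fact (n - 1) + 1"
      if "i \<in> ?U" "j \<in> ?U" "\<tau> \<in> Sym n" "\<rho> \<in> Sym n" "?ext i j \<tau> \<rho>" for i j \<tau> \<rho>
      using card_meet[of i j \<tau> \<rho>] card_meet[of i j \<rho> \<tau>] that by simp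
    have extremal: "\<exists>i\<in>?U. \<exists>j\<in>?U. \<exists>\<tau>\<in>Sym n. \<exists>\<rho>\<in>Sym n. ?ext i j \<tau> \<rho>"
      if a: "fact (n - 1) + 1 \<le> card A + ?d" and b: "fact (n - 1) + 1 \<le> card B + ?d"
    proof -
      have dense: "dense_family ?U (1 / 64) X" if X: "X \<subseteq> Sym n" "fact (n - 1) + 1 \<le> card X + ?d" for X
      proof
        \<comment> \<open>The assumed lower bound on \<open>card X\<close> exceeds by 1 the number
          of permutations in a 1-coset that meet an outside one, and this number is the same for all
          choices. \<open>transpose 1 2\<close> is just a convenient permutation moving 1.\<close>
        have t: "transpose 1 2 permutes ?U" using n by (intro permutes_swap_id) auto
        have "fact (n - 1) / 64 \<le> real (card {\<sigma>. \<sigma> permutes ?U \<and> \<sigma> 1 = 1 \<and> (\<exists>k\<in>?U. \<sigma> k = transpose 1 2 k)})"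
          using coset_meeting_large[of ?U 1 1 "transpose 1 2"] t n by simp
        moreover have "card {\<sigma>. \<sigma> permutes ?U \<and> \<sigma> 1 = 1 \<and> (\<exists>k\<in>?U. \<sigma> k = transpose 1 2 k)} + ?d = fact (n - 1)"
          using card_coset_meeting[of ?U 1 1 "transpose 1 2"] t n by simp
        then have "card {\<sigma>. \<sigma> permutes ?U \<and> \<sigma> 1 = 1 \<and> (\<exists>k\<in>?U. \<sigma> k = transpose 1 2 k)} \<le> card X"
          using X by linarith
        ultimately show "1 / 64 * fact (card ?U - 1) \<le> real (card X)" by simp
      qed (use n X in \<open>auto simp: Sym_def\<close>)
      have cross: "\<forall>\<sigma>\<in>A. \<forall>\<tau>\<in>B. \<exists>k\<in>?U. \<sigma> k = \<tau> k"
        using ci by (simp add: cross_intersecting_def perm_intersect_def)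
      have "n1 \<le> real (card ?U)" using n by simp
      from n1[OF dense[OF A a] dense[OF B b] this cross]
      obtain i j where ij: "i \<in> ?U" "j \<in> ?U"
        and sa: "real (card {\<sigma> \<in> A. \<sigma> i \<noteq> j}) \<le> fact (card ?U - 1) / 128"
        and sb: "real (card {\<sigma> \<in> B. \<sigma> i \<noteq> j}) \<le> fact (card ?U - 1) / 128" by blast
      have perms: "A \<subseteq> {\<sigma>. \<sigma> permutes ?U}" "B \<subseteq> {\<sigma>. \<sigma> permutes ?U}" using A B by (auto simp: Sym_def)
      have out': "\<not> (A \<subseteq> {\<sigma>. \<sigma> i = j} \<and> B \<subseteq> {\<sigma>. \<sigma> i = j})"
        using out[OF ij] A B by (auto simp: one_coset_def)
      show ?thesis
      proof (rule extremal_structure[OF _ _ ij perms cross out' _ _ sa sb])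
        fix \<tau> \<rho>
        assume "\<tau> permutes ?U" "\<rho> permutes ?U" "\<exists>k\<in>?U. \<tau> k = \<rho> k" "\<tau> i \<noteq> j" "\<rho> i \<noteq> j"
          "A = {\<sigma>. \<sigma> permutes ?U \<and> \<sigma> i = j \<and> (\<exists>k\<in>?U. \<sigma> k = \<tau> k)} \<union> {\<rho>}"
          "B = {\<sigma>. \<sigma> permutes ?U \<and> \<sigma> i = j \<and> (\<exists>k\<in>?U. \<sigma> k = \<rho> k)} \<union> {\<tau>}"
        then have "\<tau> \<in> Sym n" "\<rho> \<in> Sym n" "?ext i j \<tau> \<rho>"
          unfolding meet by (auto simp only: Sym_def perm_intersect_def mem_Collect_eq)
        then show ?thesis using ij by blast
      qed (use n a b in auto)
    qed
    \<comment> \<open>If both families exceeded the bound, they would have the extremal form, whose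
      sizes equal the bound.\<close>
    have bound: "min (card A) (card B) + ?d \<le> fact (n - 1) + 1"
    proof (rule ccontr)
      assume "\<not> ?thesis"
      then have a: "fact (n - 1) + 1 < card A + ?d" and b: "fact (n - 1) + 1 < card B + ?d" by auto
      from extremal[OF less_imp_le less_imp_le, OF a b] equality have "card A + ?d = fact (n - 1) + 1" by blast
      then show False using a by simp
    qed
    moreover have "min (card A) (card B) + ?d = fact (n - 1) + 1
        \<longleftrightarrow> (\<exists>i\<in>?U. \<exists>j\<in>?U. \<exists>\<tau>\<in>Sym n. \<exists>\<rho>\<in>Sym n. ?ext i j \<tau> \<rho>)"
    proof
      assume "min (card A) (card B) + ?d = fact (n - 1) + 1"
      then show "\<exists>i\<in>?U. \<exists>j\<in>?U. \<exists>\<tau>\<in>Sym n. \<exists>\<rho>\<in>Sym n. ?ext i j \<tau> \<rho>"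
        by (intro extremal) linarith+
    next
      assume "\<exists>i\<in>?U. \<exists>j\<in>?U. \<exists>\<tau>\<in>Sym n. \<exists>\<rho>\<in>Sym n. ?ext i j \<tau> \<rho>"
      then have "card A + ?d = fact (n - 1) + 1 \<and> card B + ?d = fact (n - 1) + 1" using equality by blast
      then show "min (card A) (card B) + ?d = fact (n - 1) + 1" by simp
    qed
    moreover have "int m \<le> int (fact (n - 1)) - int (derange (n - 1)) - int (derange (n - 2)) + 1 \<longleftrightarrow> m + ?d \<le> fact (n - 1) + 1"
      "int m = int (fact (n - 1)) - int (derange (n - 1)) - int (derange (n - 2)) + 1 \<longleftrightarrow> m + ?d = fact (n - 1) + 1" for m
      by linarith+
    ultimately show "int (min (card A) (card B)) \<le> int (fact (n - 1)) - int (derange (n - 1)) - int (derange (n - 2)) + 1 \<and>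
     (int (min (card A) (card B)) = int (fact (n - 1)) - int (derange (n - 1)) - int (derange (n - 2)) + 1
      \<longleftrightarrow> (\<exists>i\<in>?U. \<exists>j\<in>?U. \<exists>\<tau>\<in>Sym n. \<exists>\<rho>\<in>Sym n. ?ext i j \<tau> \<rho>))"
      by (simp only:)
  qed
qed

end
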